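(* Let $\xi$ be a Gaussian random vector in $\mathbb{R}^d$ with mean $\mathsf{E}\xi=\nu$ and nondegenerate covariance matrix $\Sigma$ (so that $\xi$ has a density). Let $X_1,X_2,\ldots$ be i.i.d. random vectors with the same law as $\xi$, and for $N\ge2$ let $H_N$ be the Kozachenko–Leonenko estimate built from $X_1,\ldots,X_N$. Then $$\lim_{N\to\infty}\mathsf{E}H_N=H\qquad\text{and}\qquad \mathsf{E}(H_N-H)^2\to0\quad(N\to\infty),$$ where $H=\frac12\log\det(2\pi e\Sigma)$.
   Context: $\rho(x,y)$ is the Euclidean distance in $\mathbb{R}^d$, $V_d=\pi^{d/2}/\Gamma(\tfrac d2+1)$ is the volume of the unit ball, $\log$ is the natural logarithm, $\gamma=-\int_0^\infty e^{-t}\log t\,dt$ is the Euler constant. The number $H$ is the differential Shannon entropy $-\int_{\mathbb{R}^d} f\log f\,dx$ of the density $f$ of $\xi$. Estimate: for $N\ge2$ and $i=1,\ldots,N$ let $\rho_i=\min\{\rho(X_i,X_j): j\in\{1,\ldots,N\}\setminus\{i\}\}$, $\overline{\rho}=(\rho_1\cdots\rho_N)^{1/N}$, and $$H_N=d\log\overline{\rho}+\log V_d+\gamma+\log(N-1).$$ *)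

theory Defs
  imports "HOL-Probability.Probability"
begin

text \<open>
  The law on \<open>\<real>\<^sup>d\<close> with independent standard normal coordinates.
\<close>

definition std_normal_vec :: "(real ^ 'd) measure" where
  "std_normal_vec = density lborel (\<lambda>z. ennreal (\<Prod>i\<in>UNIV. std_normal_density (z $ i)))"

text \<open>
  The matrix need not be invertible, so degenerate Gaussian vectors are included. A square matrix
  is enough: every positive semidefinite \<open>\<Sigma>\<close> has a square root \<open>A\<close> of its own size.
\<close>

definition gaussian_vector :: "'a measure \<Rightarrow> ('a \<Rightarrow> real ^ 'd) \<Rightarrow> bool" where
  "gaussian_vector M X \<longleftrightarrow> X \<in> borel_measurable M \<and>
     (\<exists>(A :: real ^ 'd ^ 'd) c. distr M borel X = distr std_normal_vec borel (\<lambda>z. A *v z + c))"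

definition covariance_matrix :: "'a measure \<Rightarrow> ('a \<Rightarrow> real ^ 'd) \<Rightarrow> real ^ 'd ^ 'd" where
  "covariance_matrix M X =
     (\<chi> i j. \<integral>\<omega>. (X \<omega> $ i - (\<integral>\<omega>'. X \<omega>' $ i \<partial>M)) * (X \<omega> $ j - (\<integral>\<omega>'. X \<omega>' $ j \<partial>M)) \<partial>M)"

definition is_density_of :: "('b::euclidean_space \<Rightarrow> real) \<Rightarrow> 'a measure \<Rightarrow> ('a \<Rightarrow> 'b) \<Rightarrow> bool" where
  "is_density_of f M X \<longleftrightarrow> (\<forall>x. 0 \<le> f x) \<and> distributed M lborel X (\<lambda>x. ennreal (f x))"

definition differential_entropy :: "('b::euclidean_space \<Rightarrow> real) \<Rightarrow> real" where
  "differential_entropy f = - (\<integral>x. f x * ln (f x) \<partial>lborel)"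

text \<open>
  Sample points are indexed by \<open>{1..N}\<close>; the value at index \<open>0\<close> is never used.
\<close>

definition nn_dist :: "(nat \<Rightarrow> 'b::metric_space) \<Rightarrow> nat \<Rightarrow> nat \<Rightarrow> real" where
  "nn_dist x N i = Min ((\<lambda>j. dist (x i) (x j)) ` ({1..N} - {i}))"

definition mean_nn_dist :: "(nat \<Rightarrow> 'b::metric_space) \<Rightarrow> nat \<Rightarrow> real" where
  "mean_nn_dist x N = root N (\<Prod>i=1..N. nn_dist x N i)"

text \<open>
  Coincident sample points (a null event when the law has a density) make the geometric mean
  vanish; there \<open>ln 0 = 0\<close> applies, where the mathematical value would be \<open>-\<infinity>\<close>.
\<close>

definition kl_estimate :: "(nat \<Rightarrow> real ^ 'd) \<Rightarrow> nat \<Rightarrow> real" where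
  "kl_estimate x N = real CARD('d) * ln (mean_nn_dist x N) + ln (unit_ball_vol (real CARD('d)))
     + euler_mascheroni + ln (real N - 1)"

end

theory Submission
  imports Defs
begin

text \<open>
  Write \<open>H\<^sub>N\<close> as the mean of \<open>T\<^sub>i = d ln \<rho>\<^sub>i + ln V + \<gamma> + ln (N - 1)\<close>. Given the positions \<open>x\<close> and \<open>y\<close> of two
  sample points, the other \<open>N - 2\<close> points all avoid the balls of radii \<open>r\<close> and \<open>t\<close> around them with probability
  \<open>(1 - \<mu> (cball x r \<union> cball y t)) ^ (N - 2)\<close>. For the radii belonging to the events \<open>T\<^sub>i > s\<close> and \<open>T\<^sub>j > t\<close> the
  two balls eventually are disjoint with masses of order \<open>1 / N\<close>, so \<open>T\<^sub>i\<close> and \<open>T\<^sub>j\<close> become independent and each has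
  the limit law of \<open>ln e - ln (f x) + \<gamma>\<close> with \<open>x\<close> drawn from the density \<open>f\<close> and \<open>e\<close> standard exponential; its mean
  is the entropy because \<open>ln e\<close> has mean \<open>- \<gamma>\<close>. Gaussian upper and lower bounds on \<open>f\<close> give exponential tails of
  \<open>T\<^sub>i\<close> uniformly in \<open>N\<close>, so by dominated convergence in the layer cake formulas for \<open>E T\<^sub>i\<close> and
  \<open>E (T\<^sub>i T\<^sub>j)\<close> these converge to \<open>H\<close> and \<open>H\<^sup>2\<close>, while \<open>E (T\<^sub>i\<^sup>2)\<close> stays bounded. Expanding the square of
  the mean gives the claim.
\<close>

section \<open>Expectations by the layer cake formula\<close>

text \<open>For a fixed sample size the distances are dependent and only their limit laws factorise.
  Second moments are therefore never split for finite N: every statement about one or two points is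
  an instance of the integral \<open>avoid2\<close>, whose value does not involve the indices.
  Dominated convergence is applied twice, first over the positions of the two points and then over
  the levels s and t. The second application needs a dominating function on the plane although only
  marginal tails are estimated; asking for marginal tails below a square solves this, because the
  smaller of two squares is at most the product of their roots.

  The delicate tail is the upper one. The density has no positive lower bound, so a ball of large
  volume around a remote point can be nearly massless, and for N = 2 there is no third point to hit
  it. What remains is that the two points lie further apart than the radius, which forces at least
  one of them far out; an exponential moment of the squared norm pays for that. So the pair of
  points is kept even for a marginal law.\<close>

definition tail_kernel :: "real \<Rightarrow> real \<Rightarrow> real" where
  "tail_kernel a s = indicator {..<a} s - indicator {..<0} s"

lemma abs_tail_kernel: "\<bar>tail_kernel a s\<bar> = indicator {min 0 a..<max 0 a} s"
  by (auto simp: tail_kernel_def indicator_def)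

lemma abs_tail_kernel_le_1: "\<bar>tail_kernel a s\<bar> \<le> 1"
  by (auto simp: tail_kernel_def indicator_def)

lemma measurable_tail_kernel [measurable (raw)]:
  assumes [measurable]: "f \<in> borel_measurable M" "g \<in> borel_measurable M"
  shows "(\<lambda>x. tail_kernel (f x) (g x)) \<in> borel_measurable M"
proof -
  have "(\<lambda>x. tail_kernel (f x) (g x))
      = (\<lambda>x. (if g x < f x then 1 else 0) - (if g x < 0 then 1 else 0))"
    by (auto simp: tail_kernel_def indicator_def)
  also have "\<dots> \<in> borel_measurable M" by measurable
  finally show ?thesis .
qed

lemma nn_integral_abs_tail_kernel: "(\<integral>\<^sup>+s. ennreal \<bar>tail_kernel a s\<bar> \<partial>lborel) = ennreal \<bar>a\<bar>"
proof -
  have "(\<integral>\<^sup>+s. ennreal \<bar>tail_kernel a s\<bar> \<partial>lborel) = emeasure lborel {min 0 a..<max 0 a}"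
    by (simp add: abs_tail_kernel ennreal_indicator)
  also have "\<dots> = ennreal \<bar>a\<bar>" by (auto simp: min_def max_def)
  finally show ?thesis .
qed

lemma integrable_tail_kernel: "integrable lborel (tail_kernel a)"
  by (rule integrableI_bounded) (auto simp: nn_integral_abs_tail_kernel)

text \<open>The usual layer cake formula covers nonnegative variables only. Subtracting the
  indicator of the negative half-line leaves \<open>{0..<a}\<close> with sign plus or
  \<open>{a..<0}\<close> with sign minus, which is integrable for \<open>a\<close> of either
  sign.\<close>

lemma integral_tail_kernel: "(\<integral>s. tail_kernel a s \<partial>lborel) = a"
proof -
  have "tail_kernel a = (\<lambda>s. indicator {0..<a} s - indicator {a..<0} s)"
    by (auto simp: tail_kernel_def indicator_def)
  moreover have "(\<integral>s. indicator {0..<a} s - indicator {a..<0} s \<partial>lborel) = (a::real)"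
    by (cases "a \<ge> 0") auto
  ultimately show ?thesis by simp
qed

lemma integral_abs_tail_kernel: "(\<integral>s. \<bar>tail_kernel a s\<bar> \<partial>lborel) = \<bar>a\<bar>"
  using nn_integral_abs_tail_kernel[of a] by (subst integral_eq_nn_integral) auto

section \<open>Moments from tail probabilities\<close>

context prob_space begin

lemma integrable_tail_kernel_comp [simp]:
  assumes "random_variable borel T" shows "integrable M (\<lambda>\<omega>. tail_kernel (T \<omega>) s)"
  using assms by (intro integrable_const_bound[where B=1]) (auto simp: abs_tail_kernel_le_1)

lemma expectation_tail_kernel:
  assumes [measurable]: "random_variable borel T"
  shows "expectation (\<lambda>\<omega>. tail_kernel (T \<omega>) s) = prob {\<omega>\<in>space M. s < T \<omega>} - indicator {..<0} s"
proof -
  have "expectation (\<lambda>\<omega>. tail_kernel (T \<omega>) s)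
      = expectation (\<lambda>\<omega>. indicator {\<omega>\<in>space M. s < T \<omega>} \<omega> - indicator {..<0} s)"
    by (intro Bochner_Integration.integral_cong) (auto simp: tail_kernel_def indicator_def)
  also have "\<dots> = prob {\<omega>\<in>space M. s < T \<omega>} - indicator {..<0} s"
    by (subst Bochner_Integration.integral_diff)
       (auto simp: prob_space less_top[symmetric])
  finally show ?thesis .
qed

text \<open>Fubini for the kernel on the product of \<open>M\<close> and the line. It makes a mean a
  function of the survival probabilities alone: read forwards this gives limits and equality of
  means, read backwards it evaluates the integral of \<open>survival\<close>.\<close>

lemma expectation_eq_integral_tail:
  assumes T: "integrable M T"
  shows "has_bochner_integral lborel (\<lambda>s. prob {\<omega>\<in>space M. s < T \<omega>} - indicator {..<0} s)
           (expectation T)"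
proof -
  have [measurable]: "random_variable borel T" using T by auto
  interpret P: pair_sigma_finite M "lborel :: real measure" ..
  have int: "integrable (M \<Otimes>\<^sub>M lborel) (\<lambda>(\<omega>, s). tail_kernel (T \<omega>) s)"
    by (rule P.Fubini_integrable)
       (use T in \<open>auto simp: integral_abs_tail_kernel integrable_tail_kernel\<close>)
  have "integrable lborel (\<lambda>s. expectation (\<lambda>\<omega>. tail_kernel (T \<omega>) s))"
    using P.integrable_snd[OF int] by simp
  moreover have "(\<integral>s. expectation (\<lambda>\<omega>. tail_kernel (T \<omega>) s) \<partial>lborel) = expectation T"
    using P.Fubini_integral[OF int] by (simp add: integral_tail_kernel)
  ultimately show ?thesis
    by (simp add: has_bochner_integral_iff expectation_tail_kernel)
qed

text \<open>The expectation is the upper tail probability for nonnegative s and the lower one for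
  negative s. The square prepares products: \<open>q\<close> itself, not its square, becomes the
  dominating function on the line, and \<open>q s * q t\<close> the one on the plane.\<close>

definition tail_bounded :: "(real \<Rightarrow> real) \<Rightarrow> ('a \<Rightarrow> real) \<Rightarrow> bool" where
  "tail_bounded q T \<longleftrightarrow> random_variable borel T \<and>
     (\<forall>s. expectation (\<lambda>\<omega>. \<bar>tail_kernel (T \<omega>) s\<bar>) \<le> (q s)\<^sup>2)"

lemma tail_boundedI:
  assumes [measurable]: "random_variable borel T"
    and up: "\<And>s. s \<ge> 0 \<Longrightarrow> prob {\<omega>\<in>space M. s < T \<omega>} \<le> (q s)\<^sup>2"
    and lo: "\<And>s. s < 0 \<Longrightarrow> prob {\<omega>\<in>space M. T \<omega> \<le> s} \<le> (q s)\<^sup>2"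
  shows "tail_bounded q T"
  unfolding tail_bounded_def
proof safe
  fix s
  show "expectation (\<lambda>\<omega>. \<bar>tail_kernel (T \<omega>) s\<bar>) \<le> (q s)\<^sup>2"
  proof (cases "s \<ge> 0")
    case True
    have "expectation (\<lambda>\<omega>. \<bar>tail_kernel (T \<omega>) s\<bar>) = expectation (indicator {\<omega>\<in>space M. s < T \<omega>})"
      using True by (intro Bochner_Integration.integral_cong) (auto simp: tail_kernel_def indicator_def)
    with up[OF True] show ?thesis by simp
  next
    case False
    have "expectation (\<lambda>\<omega>. \<bar>tail_kernel (T \<omega>) s\<bar>) = expectation (indicator {\<omega>\<in>space M. T \<omega> \<le> s})"
      using False by (intro Bochner_Integration.integral_cong) (auto simp: tail_kernel_def indicator_def)
    with lo[of s] False show ?thesis by simp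
  qed
qed auto

text \<open>Works for dependent \<open>T\<close> and \<open>S\<close>. Each kernel is bounded by 1,
  so the expectation is below either marginal bound, and the smaller of \<open>(q s)\<^sup>2\<close>
  and \<open>(q t)\<^sup>2\<close> is at most \<open>q s * q t\<close>.\<close>

lemma tail_bounded_mult_le:
  assumes T: "tail_bounded q T" and S: "tail_bounded q S" and q: "\<And>s. 0 \<le> q s"
  shows "expectation (\<lambda>\<omega>. \<bar>tail_kernel (T \<omega>) s * tail_kernel (S \<omega>) t\<bar>) \<le> q s * q t"
proof -
  have [measurable]: "random_variable borel T" "random_variable borel S"
    using T S by (auto simp: tail_bounded_def)
  let ?e = "expectation (\<lambda>\<omega>. \<bar>tail_kernel (T \<omega>) s * tail_kernel (S \<omega>) t\<bar>)"
  have "?e \<le> expectation (\<lambda>\<omega>. \<bar>tail_kernel (T \<omega>) s\<bar>)"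
    by (intro integral_mono integrable_abs integrable_tail_kernel_comp integrable_const_bound[where B=1])
       (auto simp: abs_mult abs_tail_kernel_le_1 intro!: mult_le_one mult_right_le_one_le)
  also have "\<dots> \<le> (q s)\<^sup>2" using T by (auto simp: tail_bounded_def)
  finally have 1: "?e \<le> (q s)\<^sup>2" .
  have "?e \<le> expectation (\<lambda>\<omega>. \<bar>tail_kernel (S \<omega>) t\<bar>)"
    by (intro integral_mono integrable_abs integrable_tail_kernel_comp integrable_const_bound[where B=1])
       (auto simp: abs_mult abs_tail_kernel_le_1 intro!: mult_le_one mult_left_le_one_le)
  also have "\<dots> \<le> (q t)\<^sup>2" using S by (auto simp: tail_bounded_def)
  finally have 2: "?e \<le> (q t)\<^sup>2" .
  show ?thesis
  proof (cases "q s \<le> q t")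
    case True
    have "(q s)\<^sup>2 \<le> q s * q t" using True q by (simp add: power2_eq_square mult_left_mono)
    with 1 show ?thesis by simp
  next
    case False
    have "(q t)\<^sup>2 \<le> q s * q t" using False q by (simp add: power2_eq_square mult_right_mono)
    with 2 show ?thesis by simp
  qed
qed

lemma lborel_square:
  fixes q :: "real \<Rightarrow> real"
  assumes q: "integrable lborel q"
  shows integrable_lborel_square: "integrable (lborel \<Otimes>\<^sub>M lborel) (\<lambda>(s, t). q s * q t)"
    and integral_lborel_square:
      "(\<integral>(s, t). q s * q t \<partial>(lborel \<Otimes>\<^sub>M lborel)) = (\<integral>s. q s \<partial>lborel)\<^sup>2"
proof -
  have [measurable]: "q \<in> borel_measurable borel" using q by auto
  show int: "integrable (lborel \<Otimes>\<^sub>M lborel) (\<lambda>(s, t). q s * q t)"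
    by (rule lborel_pair.Fubini_integrable) (use q in \<open>auto simp: abs_mult\<close>)
  show "(\<integral>(s, t). q s * q t \<partial>(lborel \<Otimes>\<^sub>M lborel)) = (\<integral>s. q s \<partial>lborel)\<^sup>2"
    using lborel_pair.integral_fst'[OF int] by (simp add: power2_eq_square)
qed

lemma tail_bounded_mult:
  assumes T: "tail_bounded q T" and S: "tail_bounded q S"
    and q: "\<And>s. 0 \<le> q s" and qi: "integrable lborel q"
  shows "integrable M (\<lambda>\<omega>. T \<omega> * S \<omega>)" (is ?A)
    and "expectation (\<lambda>\<omega>. \<bar>T \<omega> * S \<omega>\<bar>) \<le> (\<integral>s. q s \<partial>lborel)\<^sup>2" (is ?B)
    and "expectation (\<lambda>\<omega>. T \<omega> * S \<omega>)
       = (\<integral>(s, t). expectation (\<lambda>\<omega>. tail_kernel (T \<omega>) s * tail_kernel (S \<omega>) t) \<partial>(lborel \<Otimes>\<^sub>M lborel))"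
      (is ?C)
proof -
  have [measurable]: "random_variable borel T" "random_variable borel S"
    using T S by (auto simp: tail_bounded_def)
  have [measurable]: "q \<in> borel_measurable borel" using qi by auto
  let ?L = "lborel \<Otimes>\<^sub>M lborel :: (real \<times> real) measure"
  interpret P: pair_sigma_finite M ?L ..
  define F where "F = (\<lambda>\<omega> x. tail_kernel (T \<omega>) (fst x) * tail_kernel (S \<omega>) (snd x))"
  have F[measurable]: "case_prod F \<in> borel_measurable (M \<Otimes>\<^sub>M ?L)"
    unfolding F_def by measurable
  have hb: "has_bochner_integral ?L (F \<omega>) (T \<omega> * S \<omega>)"
       "has_bochner_integral ?L (\<lambda>x. \<bar>F \<omega> x\<bar>) \<bar>T \<omega> * S \<omega>\<bar>" for \<omega>
  proof -
    have int: "integrable ?L (F \<omega>)"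
      unfolding F_def by (rule lborel_pair.Fubini_integrable) (auto simp: abs_mult integrable_tail_kernel)
    show "has_bochner_integral ?L (F \<omega>) (T \<omega> * S \<omega>)"
      using lborel_pair.integral_fst'[OF int] int
      by (simp add: has_bochner_integral_iff integral_tail_kernel F_def)
    have int': "integrable ?L (\<lambda>x. \<bar>F \<omega> x\<bar>)"
      using int by simp
    show "has_bochner_integral ?L (\<lambda>x. \<bar>F \<omega> x\<bar>) \<bar>T \<omega> * S \<omega>\<bar>"
      using lborel_pair.integral_fst'[OF int'] int'
      by (simp add: has_bochner_integral_iff integral_abs_tail_kernel F_def abs_mult)
  qed
  have Fi: "integrable M (\<lambda>\<omega>. F \<omega> x)" for x
    by (intro integrable_const_bound[where B=1])
       (auto simp: F_def abs_mult abs_tail_kernel_le_1 intro!: mult_le_one)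
  have bd: "expectation (\<lambda>\<omega>. \<bar>F \<omega> x\<bar>) \<le> (case x of (s, t) \<Rightarrow> q s * q t)" for x
    using tail_bounded_mult_le[OF T S q, of "fst x" "snd x"] by (simp add: F_def case_prod_beta)
  note qq = lborel_square[OF qi]
  have intabs: "integrable ?L (\<lambda>x. expectation (\<lambda>\<omega>. \<bar>F \<omega> x\<bar>))"
    by (rule Bochner_Integration.integrable_bound[OF qq(1)])
       (use bd q in \<open>auto simp: case_prod_unfold intro!: AE_I2\<close>)
  \<comment> \<open>The bound \<open>bd\<close> holds for fixed levels after integrating out the
    sample space. Fubini's criterion is therefore applied with the plane as the outer factor, and
    the factors are swapped afterwards.\<close>
  have "integrable (?L \<Otimes>\<^sub>M M) (\<lambda>(x, \<omega>). F \<omega> x)"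
  proof -
    interpret Q: pair_sigma_finite ?L M ..
    show ?thesis
      by (rule Q.Fubini_integrable) (use intabs Fi in auto)
  qed
  then have int: "integrable (M \<Otimes>\<^sub>M ?L) (\<lambda>(\<omega>, x). F \<omega> x)"
    using P.integrable_product_swap_iff[of "\<lambda>(\<omega>, x). F \<omega> x"] by simp
  have hb1: "(\<integral>x. F \<omega> x \<partial>?L) = T \<omega> * S \<omega>" "(\<integral>x. \<bar>F \<omega> x\<bar> \<partial>?L) = \<bar>T \<omega> * S \<omega>\<bar>" for \<omega>
    using hb[of \<omega>] by (auto simp: has_bochner_integral_iff)
  show ?A using P.integrable_fst[OF int] by (simp add: hb1)
  have "expectation (\<lambda>\<omega>. T \<omega> * S \<omega>) = (\<integral>x. expectation (\<lambda>\<omega>. F \<omega> x) \<partial>?L)"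
    using P.Fubini_integral[OF int] by (simp add: hb1)
  then show ?C by (simp add: F_def case_prod_unfold)
  have inta: "integrable (M \<Otimes>\<^sub>M ?L) (\<lambda>(\<omega>, x). \<bar>F \<omega> x\<bar>)"
  proof -
    have "(\<lambda>(\<omega>, x). \<bar>F \<omega> x\<bar>) = (\<lambda>p. \<bar>case_prod F p\<bar>)" by auto
    then show ?thesis using integrable_abs[OF int] by (simp only:)
  qed
  have "expectation (\<lambda>\<omega>. \<bar>T \<omega> * S \<omega>\<bar>) = (\<integral>x. expectation (\<lambda>\<omega>. \<bar>F \<omega> x\<bar>) \<partial>?L)"
    using P.Fubini_integral[OF inta] by (simp add: hb1)
  also have "\<dots> \<le> (\<integral>(s, t). q s * q t \<partial>?L)"
    using bd intabs qq(1) by (intro integral_mono) auto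
  also have "\<dots> = (\<integral>s. q s \<partial>lborel)\<^sup>2" by (rule qq(2))
  finally show ?B .
qed

lemma tail_bounded_integrable:
  assumes T: "tail_bounded q T" and q: "\<And>s. 0 \<le> q s" and qi: "integrable lborel q"
  shows "integrable M T"
proof (rule square_integrable_imp_integrable)
  show "random_variable borel T" using T by (simp add: tail_bounded_def)
  show "integrable M (\<lambda>\<omega>. (T \<omega>)\<^sup>2)"
    using tail_bounded_mult(1)[OF T T q qi] by (simp add: power2_eq_square)
qed

lemma expectation_tail_kernel_mult:
  assumes [measurable]: "random_variable borel T" "random_variable borel S"
  shows "expectation (\<lambda>\<omega>. tail_kernel (T \<omega>) s * tail_kernel (S \<omega>) t)
    = prob {\<omega>\<in>space M. s < T \<omega> \<and> t < S \<omega>} - indicator {..<0} s * prob {\<omega>\<in>space M. t < S \<omega>}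
      - indicator {..<0} t * prob {\<omega>\<in>space M. s < T \<omega>} + indicator {..<0} s * indicator {..<0} t"
proof -
  let ?A = "{\<omega>\<in>space M. s < T \<omega>}" and ?B = "{\<omega>\<in>space M. t < S \<omega>}"
  have "expectation (\<lambda>\<omega>. tail_kernel (T \<omega>) s * tail_kernel (S \<omega>) t)
     = expectation (\<lambda>\<omega>. indicator {\<omega>\<in>space M. s < T \<omega> \<and> t < S \<omega>} \<omega>
         - indicator {..<0} s * indicator ?B \<omega> - indicator {..<0} t * indicator ?A \<omega>
         + indicator {..<0} s * indicator {..<0} t)"
    by (intro Bochner_Integration.integral_cong) (auto simp: tail_kernel_def indicator_def)
  also have "\<dots> = prob {\<omega>\<in>space M. s < T \<omega> \<and> t < S \<omega>} - indicator {..<0} s * prob ?B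
      - indicator {..<0} t * prob ?A + indicator {..<0} s * indicator {..<0} t"
    by (simp add: prob_space integrable_real_indicator less_top[symmetric])
  finally show ?thesis .
qed

lemma expectation_tendsto_of_tail:
  assumes T: "\<And>n. tail_bounded q (T n)" and q: "\<And>s. 0 \<le> q s" and qi: "integrable lborel q"
    and lim: "\<And>s. (\<lambda>n. prob {\<omega>\<in>space M. s < T n \<omega>}) \<longlonglongrightarrow> G s"
    and [measurable]: "G \<in> borel_measurable borel"
  shows "(\<lambda>n. expectation (T n)) \<longlonglongrightarrow> (\<integral>s. G s - indicator {..<0} s \<partial>lborel)"
    and "integrable lborel (\<lambda>s. G s - indicator {..<0} s)"
proof -
  have [measurable]: "random_variable borel (T n)" for n
    using T by (auto simp: tail_bounded_def)
  note hb = expectation_eq_integral_tail[OF tail_bounded_integrable[OF T q qi]]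
  have bd: "\<bar>prob {\<omega>\<in>space M. s < T n \<omega>} - indicator {..<0} s\<bar> \<le> q s" for n s
  proof -
    have "\<bar>expectation (\<lambda>\<omega>. tail_kernel (T n \<omega>) s)\<bar> \<le> expectation (\<lambda>\<omega>. \<bar>tail_kernel (T n \<omega>) s\<bar>)"
      by (rule integral_abs_bound)
    then have 1: "\<bar>prob {\<omega>\<in>space M. s < T n \<omega>} - indicator {..<0} s\<bar>
        \<le> expectation (\<lambda>\<omega>. \<bar>tail_kernel (T n \<omega>) s\<bar>)"
      by (simp add: expectation_tail_kernel)
    have 2: "expectation (\<lambda>\<omega>. \<bar>tail_kernel (T n \<omega>) s\<bar>) \<le> (q s)\<^sup>2"
      using T by (auto simp: tail_bounded_def)
    have 3: "\<bar>prob {\<omega>\<in>space M. s < T n \<omega>} - indicator {..<0} s\<bar> \<le> 1"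
      by (auto simp: indicator_def)
    show ?thesis
    \<comment> \<open>The tail bound supplies the square of \<open>q s\<close>, which is below
      \<open>q s\<close> only when \<open>q s\<close> is at most 1; otherwise the trivial bound 1
      takes over.\<close>
    proof (cases "q s \<le> 1")
      case True
      then have "(q s)\<^sup>2 \<le> q s" using q by (simp add: power2_eq_square mult_left_le)
      with 1 2 show ?thesis by linarith
    qed (use 3 in linarith)
  qed
  have m: "(\<lambda>s. prob {\<omega>\<in>space M. s < T n \<omega>} - indicator {..<0} s) \<in> borel_measurable lborel" for n
    using hb[of n] by (auto simp: has_bochner_integral_iff)
  have l: "AE s in lborel. (\<lambda>n. prob {\<omega>\<in>space M. s < T n \<omega>} - indicator {..<0} s)
      \<longlonglongrightarrow> G s - indicator {..<0} s"
    by (auto intro!: tendsto_intros lim)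
  have E: "(\<integral>s. prob {\<omega>\<in>space M. s < T n \<omega>} - indicator {..<0} s \<partial>lborel) = expectation (T n)" for n
    using hb[of n] by (auto simp: has_bochner_integral_iff)
  show "(\<lambda>n. expectation (T n)) \<longlonglongrightarrow> (\<integral>s. G s - indicator {..<0} s \<partial>lborel)"
    unfolding E[symmetric]
    by (rule integral_dominated_convergence[OF _ m qi l]) (use bd in auto)
  show "integrable lborel (\<lambda>s. G s - indicator {..<0} s)"
    by (rule integrable_dominated_convergence[OF _ m qi l]) (use bd in auto)
qed

lemma expectation_mult_tendsto_of_tail:
  assumes T: "\<And>n. tail_bounded q (T n)" and S: "\<And>n. tail_bounded q (S n)"
    and q: "\<And>s. 0 \<le> q s" and qi: "integrable lborel q"
    and limT: "\<And>s. (\<lambda>n. prob {\<omega>\<in>space M. s < T n \<omega>}) \<longlonglongrightarrow> G s"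
    and limS: "\<And>s. (\<lambda>n. prob {\<omega>\<in>space M. s < S n \<omega>}) \<longlonglongrightarrow> G s"
    and lim: "\<And>s t. (\<lambda>n. prob {\<omega>\<in>space M. s < T n \<omega> \<and> t < S n \<omega>}) \<longlonglongrightarrow> G s * G t"
    and [measurable]: "G \<in> borel_measurable borel"
  shows "(\<lambda>n. expectation (\<lambda>\<omega>. T n \<omega> * S n \<omega>)) \<longlonglongrightarrow> (\<integral>s. G s - indicator {..<0} s \<partial>lborel)\<^sup>2"
proof -
  have [measurable]: "random_variable borel (T n)" "random_variable borel (S n)" for n
    using T S by (auto simp: tail_bounded_def)
  let ?L = "lborel \<Otimes>\<^sub>M lborel :: (real \<times> real) measure"
  let ?G = "\<lambda>s. G s - indicator {..<0} s"
  define F where "F = (\<lambda>n (s, t). expectation (\<lambda>\<omega>. tail_kernel (T n \<omega>) s * tail_kernel (S n \<omega>) t))"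
  have Fm: "F n \<in> borel_measurable ?L" for n
    unfolding F_def by measurable
  \<comment> \<open>In the limit the four terms of \<open>expectation_tail_kernel_mult\<close>
    factor into \<open>?G s * ?G t\<close>, which turns the integral over the plane into a
    square.\<close>
  have FL: "(\<lambda>n. F n x) \<longlonglongrightarrow> (case x of (s, t) \<Rightarrow> ?G s * ?G t)" for x
  proof -
    obtain s t where x: "x = (s, t)" by (cases x)
    have "(\<lambda>n. F n x) \<longlonglongrightarrow> G s * G t - indicator {..<0} s * G t - indicator {..<0} t * G s
        + indicator {..<0} s * indicator {..<0} t"
      unfolding F_def x prod.case
      by (subst expectation_tail_kernel_mult) (auto intro!: tendsto_intros limT limS lim)
    then show ?thesis by (simp add: x algebra_simps)
  qed
  have bd: "norm (F n x) \<le> (case x of (s, t) \<Rightarrow> q s * q t)" for n x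
  proof -
    obtain s t where x: "x = (s, t)" by (cases x)
    have "\<bar>F n x\<bar> \<le> expectation (\<lambda>\<omega>. \<bar>tail_kernel (T n \<omega>) s * tail_kernel (S n \<omega>) t\<bar>)"
      unfolding F_def x prod.case by (rule integral_abs_bound)
    also have "\<dots> \<le> q s * q t" by (rule tail_bounded_mult_le[OF T S q])
    finally show ?thesis by (simp add: x)
  qed
  have "(\<lambda>n. \<integral>x. F n x \<partial>?L) \<longlonglongrightarrow> (\<integral>(s, t). ?G s * ?G t \<partial>?L)"
    by (rule integral_dominated_convergence[OF _ Fm
         integrable_lborel_square[OF qi]])
       (use FL bd in auto)
  moreover have "(\<integral>(s, t). ?G s * ?G t \<partial>?L) = (\<integral>s. ?G s \<partial>lborel)\<^sup>2"
    by (rule integral_lborel_square) (auto intro!: expectation_tendsto_of_tail(2)[OF T q qi limT])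
  moreover have "(\<integral>x. F n x \<partial>?L) = expectation (\<lambda>\<omega>. T n \<omega> * S n \<omega>)" for n
    unfolding F_def by (rule tail_bounded_mult(3)[OF T S q qi, symmetric])
  ultimately show ?thesis by simp
qed

end

section \<open>Nearest-neighbour distances of an i.i.d. sample\<close>

text \<open>
  With \<open>n = N - 2\<close> this is the probability that \<open>\<rho>\<^sub>i > r\<close> and \<open>\<rho>\<^sub>j > t\<close>. Marginals arise for \<open>t = -1\<close>, where
  \<open>cball y t\<close> is empty.
\<close>

definition avoid2 :: "'b::metric_space measure \<Rightarrow> nat \<Rightarrow> real \<Rightarrow> real \<Rightarrow> real" where
  "avoid2 \<mu> n r t = (\<integral>p. indicator {p. max r t < dist (fst p) (snd p)} p
     * (1 - measure \<mu> (cball (fst p) r \<union> cball (snd p) t)) ^ n \<partial>(\<mu> \<Otimes>\<^sub>M \<mu>))"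

text \<open>Independence makes the joint law a product measure. Coordinates \<open>i\<close> and
  \<open>j\<close> are peeled off first; once they are fixed, the factors for \<open>J\<close>
  depend on separate coordinates with a common law, hence the power. Nonnegative integrals avoid any
  integrability condition.\<close>

lemma (in prob_space) nn_integral_iid_pair:
  fixes X :: "nat \<Rightarrow> 'a \<Rightarrow> 'b::second_countable_topology"
  assumes ind: "indep_vars (\<lambda>_. borel) X (insert i (insert j J))"
    and J: "finite J" "i \<notin> J" "j \<notin> J" "i \<noteq> j"
    and D: "\<And>k. k \<in> insert i (insert j J) \<Longrightarrow> distr M borel (X k) = \<mu>"
    and G[measurable]: "case_prod G \<in> borel_measurable (borel \<Otimes>\<^sub>M borel)"
    and Q[measurable]: "(\<lambda>(x, y, z). Q x y z) \<in> borel_measurable (borel \<Otimes>\<^sub>M borel \<Otimes>\<^sub>M borel)"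
  shows "(\<integral>\<^sup>+\<omega>. G (X i \<omega>) (X j \<omega>) * (\<Prod>k\<in>J. Q (X i \<omega>) (X j \<omega>) (X k \<omega>)) \<partial>M)
    = (\<integral>\<^sup>+x. \<integral>\<^sup>+y. G x y * (\<integral>\<^sup>+z. Q x y z \<partial>\<mu>) ^ card J \<partial>\<mu> \<partial>\<mu>)"
proof -
  let ?L = "insert i (insert j J)"
  have X[measurable]: "random_variable borel (X k)" if "k \<in> ?L" for k
    using ind that by (auto simp: indep_vars_def)
  have sets_mu[measurable_cong]: "sets \<mu> = sets borel"
    using D[of i] by (metis insertI1 sets_distr)
  have "prob_space \<mu>" using prob_space_distr[OF X[of i]] D[of i] by simp
  then interpret mu: prob_space \<mu> .
  interpret Pi: product_sigma_finite "\<lambda>_. \<mu>" ..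
  define h where "h = (\<lambda>x. G (x i) (x j) * (\<Prod>k\<in>J. Q (x i) (x j) (x k)))"
  have hm[measurable]: "h \<in> borel_measurable (Pi\<^sub>M ?L (\<lambda>_. \<mu>))"
  proof -
    have "(\<lambda>x. Q (x i) (x j) (x k)) \<in> borel_measurable (Pi\<^sub>M ?L (\<lambda>_. \<mu>))" if "k \<in> J" for k
      using measurable_compose[OF _ Q, of "\<lambda>x. (x i, x j, x k)" "Pi\<^sub>M ?L (\<lambda>_. \<mu>)"] that by simp
    moreover have "(\<lambda>x. G (x i) (x j)) \<in> borel_measurable (Pi\<^sub>M ?L (\<lambda>_. \<mu>))"
      by measurable
    ultimately show ?thesis unfolding h_def by measurable
  qed
  have PiM: "distr M (Pi\<^sub>M ?L (\<lambda>_. borel)) (\<lambda>x. \<lambda>k\<in>?L. X k x) = Pi\<^sub>M ?L (\<lambda>_. \<mu>)"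
  proof -
    have "distr M (Pi\<^sub>M ?L (\<lambda>_. borel)) (\<lambda>x. \<lambda>k\<in>?L. X k x) = Pi\<^sub>M ?L (\<lambda>k. distr M borel (X k))"
      using ind X by (subst (asm) indep_vars_iff_distr_eq_PiM') auto
    also have "\<dots> = Pi\<^sub>M ?L (\<lambda>_. \<mu>)" by (intro PiM_cong) (auto simp: D)
    finally show ?thesis .
  qed
  have hm2: "h \<in> borel_measurable (Pi\<^sub>M ?L (\<lambda>_. borel))"
    using hm by (simp add: measurable_def sets_PiM_cong[OF refl sets_mu] space_PiM sets_eq_imp_space_eq[OF sets_mu])
  have "(\<integral>\<^sup>+\<omega>. G (X i \<omega>) (X j \<omega>) * (\<Prod>k\<in>J. Q (X i \<omega>) (X j \<omega>) (X k \<omega>)) \<partial>M)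
      = (\<integral>\<^sup>+\<omega>. h (\<lambda>k\<in>?L. X k \<omega>) \<partial>M)"
    by (intro nn_integral_cong) (auto simp: h_def intro!: arg_cong2[where f="(*)"] prod.cong)
  also have "\<dots> = (\<integral>\<^sup>+x. h x \<partial>Pi\<^sub>M ?L (\<lambda>_. \<mu>))"
    unfolding PiM[symmetric] by (rule nn_integral_distr[symmetric]) (use hm2 in measurable)
  also have "\<dots> = (\<integral>\<^sup>+x. \<integral>\<^sup>+y. (\<integral>\<^sup>+w. h (w(j := y, i := x)) \<partial>Pi\<^sub>M J (\<lambda>_. \<mu>)) \<partial>\<mu> \<partial>\<mu>)"
  proof (subst Pi.product_nn_integral_insert_rev, goal_cases)
    case 4
    show ?case
      by (intro nn_integral_cong, subst Pi.product_nn_integral_insert_rev)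
         (use J in \<open>auto intro!: measurable_compose[OF _ hm] measurable_fun_upd[where J="insert j J"]\<close>)
  qed (use J in auto)
  also have "\<dots> = (\<integral>\<^sup>+x. \<integral>\<^sup>+y. G x y * (\<integral>\<^sup>+z. Q x y z \<partial>\<mu>) ^ card J \<partial>\<mu> \<partial>\<mu>)"
  proof (intro nn_integral_cong)
    fix x y
    assume xy[measurable]: "x \<in> space \<mu>" "y \<in> space \<mu>"
    have "(\<integral>\<^sup>+w. h (w(j := y, i := x)) \<partial>Pi\<^sub>M J (\<lambda>_. \<mu>))
        = (\<integral>\<^sup>+w. G x y * (\<Prod>k\<in>J. Q x y (w k)) \<partial>Pi\<^sub>M J (\<lambda>_. \<mu>))"
      using J by (intro nn_integral_cong)
        (auto simp: h_def intro!: arg_cong2[where f="(*)"] prod.cong)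
    also have "\<dots> = G x y * (\<integral>\<^sup>+w. (\<Prod>k\<in>J. Q x y (w k)) \<partial>Pi\<^sub>M J (\<lambda>_. \<mu>))"
      by (rule nn_integral_cmult) measurable
    also have "(\<integral>\<^sup>+w. (\<Prod>k\<in>J. Q x y (w k)) \<partial>Pi\<^sub>M J (\<lambda>_. \<mu>)) = (\<integral>\<^sup>+z. Q x y z \<partial>\<mu>) ^ card J"
      by (subst Pi.product_nn_integral_prod) (use J in auto)
    finally show "(\<integral>\<^sup>+w. h (w(j := y, i := x)) \<partial>Pi\<^sub>M J (\<lambda>_. \<mu>)) = G x y * (\<integral>\<^sup>+z. Q x y z \<partial>\<mu>) ^ card J" .
  qed
  finally show ?thesis .
qed

lemma less_nn_dist_iff:
  assumes "i \<in> {1..N}" "N \<ge> 2"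
  shows "r < nn_dist x N i \<longleftrightarrow> (\<forall>k\<in>{1..N} - {i}. r < dist (x i) (x k))"
proof -
  have "card ({1..N} - {i}) \<noteq> 0" using assms by auto
  then have "{1..N} - {i} \<noteq> {}" by (metis card.empty)
  then show ?thesis unfolding nn_dist_def by (subst Min_gr_iff) auto
qed

text \<open>The union of the two balls is a section of one Borel set in the triple product, and
  masses of sections are measurable.\<close>

lemma measurable_measure_cball_Un:
  fixes \<mu> :: "'b::euclidean_space measure"
  assumes "prob_space \<mu>" and [measurable_cong]: "sets \<mu> = sets borel"
  shows "(\<lambda>p. measure \<mu> (cball (fst p) r \<union> cball (snd p) t)) \<in> borel_measurable (\<mu> \<Otimes>\<^sub>M \<mu>)"
proof -
  interpret prob_space \<mu> by fact
  have "{x \<in> space ((\<mu> \<Otimes>\<^sub>M \<mu>) \<Otimes>\<^sub>M \<mu>). dist (fst (fst x)) (snd x) \<le> r \<or> dist (snd (fst x)) (snd x) \<le> t}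
     \<in> sets ((\<mu> \<Otimes>\<^sub>M \<mu>) \<Otimes>\<^sub>M \<mu>)"
    by measurable
  then have "(\<lambda>p. emeasure \<mu> (Pair p -` {x \<in> space ((\<mu> \<Otimes>\<^sub>M \<mu>) \<Otimes>\<^sub>M \<mu>).
      dist (fst (fst x)) (snd x) \<le> r \<or> dist (snd (fst x)) (snd x) \<le> t})) \<in> borel_measurable (\<mu> \<Otimes>\<^sub>M \<mu>)"
    by (rule measurable_emeasure_Pair)
  moreover have "Pair p -` {x \<in> space ((\<mu> \<Otimes>\<^sub>M \<mu>) \<Otimes>\<^sub>M \<mu>).
      dist (fst (fst x)) (snd x) \<le> r \<or> dist (snd (fst x)) (snd x) \<le> t} = cball (fst p) r \<union> cball (snd p) t" for p
    using sets_eq_imp_space_eq[OF assms(2)] by (auto simp: space_pair_measure)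
  ultimately show ?thesis by (simp add: measure_def)
qed

text \<open>The two distinguished points are candidates for each other's nearest neighbour, which
  the indicator with \<open>max r t\<close> records. Every other point must avoid both balls, and
  given the pair these N - 2 events are independent with equal probability.\<close>

lemma (in prob_space) prob_nn_dist_pair:
  fixes X :: "nat \<Rightarrow> 'a \<Rightarrow> 'b::euclidean_space"
  assumes ind: "indep_vars (\<lambda>_. borel) X {1..}" and D: "\<And>k. k \<ge> 1 \<Longrightarrow> distr M borel (X k) = \<mu>"
    and N: "N \<ge> 2" and ij: "i \<in> {1..N}" "j \<in> {1..N}" "i \<noteq> j"
  shows "prob {\<omega>\<in>space M. r < nn_dist (\<lambda>k. X k \<omega>) N i \<and> t < nn_dist (\<lambda>k. X k \<omega>) N j}
    = avoid2 \<mu> (N - 2) r t"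
proof -
  define J where "J = {1..N} - {i, j}"
  have L: "insert i (insert j J) = {1..N}" using ij by (auto simp: J_def)
  have J: "finite J" "i \<notin> J" "j \<notin> J" by (auto simp: J_def)
  have cJ: "card J = N - 2" using ij by (simp add: J_def card_Diff_subset)
  have X[measurable]: "random_variable borel (X k)" if "k \<ge> 1" for k
    using ind that by (auto simp: indep_vars_def)
  have sets_mu[measurable_cong]: "sets \<mu> = sets borel"
    using D[of 1] by (metis order_refl sets_distr)
  have mu: "prob_space \<mu>" using prob_space_distr[OF X[of i]] D[of i] ij by simp
  interpret mu: prob_space \<mu> by (fact mu)
  interpret mm: pair_prob_space \<mu> \<mu> ..
  note meas[measurable] = measurable_measure_cball_Un[OF mu sets_mu]
  define A where "A = {\<omega>\<in>space M. r < nn_dist (\<lambda>k. X k \<omega>) N i \<and> t < nn_dist (\<lambda>k. X k \<omega>) N j}"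
  define G where "G = (\<lambda>(x::'b) (y::'b). indicator {p. max r t < dist (fst p) (snd p)} (x, y) :: ennreal)"
  define Q where "Q = (\<lambda>(x::'b) (y::'b) z. indicator (- (cball x r \<union> cball y t)) z :: ennreal)"
  have Gm: "case_prod G \<in> borel_measurable (borel \<Otimes>\<^sub>M borel)"
  proof -
    have "case_prod G = (\<lambda>p. if max r t < dist (fst p) (snd p) then 1 else 0)"
      by (auto simp: G_def indicator_def)
    also have "\<dots> \<in> borel_measurable (borel \<Otimes>\<^sub>M borel)" by measurable
    finally show ?thesis .
  qed
  have Qm: "(\<lambda>(x, y, z). Q x y z) \<in> borel_measurable (borel \<Otimes>\<^sub>M borel \<Otimes>\<^sub>M borel)"
  proof -
    have "(\<lambda>(x, y, z). Q x y z)
       = (\<lambda>p. if dist (fst p) (snd (snd p)) \<le> r \<or> dist (fst (snd p)) (snd (snd p)) \<le> t then 0 else 1)"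
      by (auto simp: Q_def indicator_def)
    also have "\<dots> \<in> borel_measurable (borel \<Otimes>\<^sub>M borel \<Otimes>\<^sub>M borel)" by measurable
    finally show ?thesis .
  qed
  have ev: "indicator A \<omega> = G (X i \<omega>) (X j \<omega>) * (\<Prod>k\<in>J. Q (X i \<omega>) (X j \<omega>) (X k \<omega>))"
    if "\<omega> \<in> space M" for \<omega>
  proof -
    have "(\<Prod>k\<in>J. Q (X i \<omega>) (X j \<omega>) (X k \<omega>)) = (if \<forall>k\<in>J. r < dist (X i \<omega>) (X k \<omega>) \<and> t < dist (X j \<omega>) (X k \<omega>) then 1 else 0)"
      using J(1) by (auto simp: Q_def prod_zero_iff indicator_def not_le)
    moreover have "\<omega> \<in> A \<longleftrightarrow> max r t < dist (X i \<omega>) (X j \<omega>) \<and> (\<forall>k\<in>J. r < dist (X i \<omega>) (X k \<omega>) \<and> t < dist (X j \<omega>) (X k \<omega>))"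
    proof -
      have e: "{1..N} - {i} = insert j J" "{1..N} - {j} = insert i J" using ij by (auto simp: J_def)
      show ?thesis
        unfolding A_def mem_Collect_eq less_nn_dist_iff[OF ij(1) N] less_nn_dist_iff[OF ij(2) N] e
        using that by (auto simp: dist_commute)
    qed
    ultimately show ?thesis by (auto simp: G_def indicator_def)
  qed
  have "{\<omega>\<in>space M. r < nn_dist (\<lambda>k. X k \<omega>) N i \<and> t < nn_dist (\<lambda>k. X k \<omega>) N j} =
     {\<omega>\<in>space M. (\<forall>k\<in>{1..N} - {i}. r < dist (X i \<omega>) (X k \<omega>)) \<and> (\<forall>k\<in>{1..N} - {j}. t < dist (X j \<omega>) (X k \<omega>))}"
    by (simp only: less_nn_dist_iff[OF ij(1) N] less_nn_dist_iff[OF ij(2) N])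
  also have "\<dots> \<in> events"
  proof -
    have m: "{\<omega>\<in>space M. u < dist (X a \<omega>) (X b \<omega>)} \<in> events" if "a \<ge> 1" "b \<ge> 1" for u a b
    proof -
      have [measurable]: "random_variable borel (X a)" "random_variable borel (X b)"
        using that by (auto intro: X)
      show ?thesis by measurable
    qed
    show ?thesis
      by (intro sets.sets_Collect_conj sets.sets_Collect_finite_All m) (use ij in auto)
  qed
  finally have A[measurable]: "A \<in> events" by (simp add: A_def)
  have q: "(\<integral>\<^sup>+z. Q x y z \<partial>\<mu>) = ennreal (1 - measure \<mu> (cball x r \<union> cball y t))" for x y
  proof -
    have "(\<integral>\<^sup>+z. Q x y z \<partial>\<mu>) = emeasure \<mu> (space \<mu> - (cball x r \<union> cball y t))"
      unfolding Q_def using sets_eq_imp_space_eq[OF sets_mu]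
      by (subst nn_integral_indicator) (auto simp: sets_mu Compl_eq_Diff_UNIV)
    then show ?thesis
      by (simp add: mu.emeasure_eq_measure mu.prob_compl sets_mu)
  qed
  have int: "integrable (\<mu> \<Otimes>\<^sub>M \<mu>) (\<lambda>p. indicator {p. max r t < dist (fst p) (snd p)} p
     * (1 - measure \<mu> (cball (fst p) r \<union> cball (snd p) t)) ^ (N - 2))"
  proof (rule mm.P.integrable_const_bound[where B=1])
    have "(\<lambda>p. indicator {p. max r t < dist (fst p) (snd p)} p) = (\<lambda>p. if max r t < dist (fst p) (snd p) then 1 else 0::real)"
      by (auto simp: indicator_def)
    also have "\<dots> \<in> borel_measurable (\<mu> \<Otimes>\<^sub>M \<mu>)" by measurable
    finally have [measurable]: "indicat_real {p. max r t < dist (fst p) (snd p)} \<in> borel_measurable (\<mu> \<Otimes>\<^sub>M \<mu>)" .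
    show "(\<lambda>p. indicator {p. max r t < dist (fst p) (snd p)} p
      * (1 - measure \<mu> (cball (fst p) r \<union> cball (snd p) t)) ^ (N - 2)) \<in> borel_measurable (\<mu> \<Otimes>\<^sub>M \<mu>)"
      by measurable
  qed (auto simp: abs_mult indicator_def power_le_one)
  have "ennreal (prob A) = (\<integral>\<^sup>+\<omega>. G (X i \<omega>) (X j \<omega>) * (\<Prod>k\<in>J. Q (X i \<omega>) (X j \<omega>) (X k \<omega>)) \<partial>M)"
    by (simp add: emeasure_eq_measure[symmetric] ev[symmetric] cong: nn_integral_cong_simp)
  also have "\<dots> = (\<integral>\<^sup>+x. \<integral>\<^sup>+y. G x y * (\<integral>\<^sup>+z. Q x y z \<partial>\<mu>) ^ card J \<partial>\<mu> \<partial>\<mu>)"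
    by (rule nn_integral_iid_pair[OF _ J ij(3) _ Gm Qm])
       (use L D in \<open>auto intro: indep_vars_subset[OF ind]\<close>)
  also have "\<dots> = (\<integral>\<^sup>+x. \<integral>\<^sup>+y. ennreal (indicator {p. max r t < dist (fst p) (snd p)} (x, y)
     * (1 - measure \<mu> (cball x r \<union> cball y t)) ^ (N - 2)) \<partial>\<mu> \<partial>\<mu>)"
    by (simp add: q cJ G_def ennreal_mult ennreal_power ennreal_indicator)
  also have "\<dots> = (\<integral>\<^sup>+p. ennreal (indicator {p. max r t < dist (fst p) (snd p)} p
     * (1 - measure \<mu> (cball (fst p) r \<union> cball (snd p) t)) ^ (N - 2)) \<partial>(\<mu> \<Otimes>\<^sub>M \<mu>))"
    using int by (subst mu.nn_integral_fst[symmetric]) auto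
  also have "\<dots> = ennreal (avoid2 \<mu> (N - 2) r t)"
    unfolding avoid2_def by (rule nn_integral_eq_integral[OF int]) auto
  finally show ?thesis
    unfolding A_def[symmetric]
    by (subst (asm) ennreal_inj) (auto simp: avoid2_def intro!: integral_nonneg_AE)
qed

section \<open>The logarithm of an exponential variable\<close>

text \<open>Both bounds are \<open>1 + u <= exp u\<close>, with u = h ln t and u = - h ln t. They
  trap the logarithm between powers, whose exponential means are values of the Gamma
  function.\<close>

lemma ln_between_powr:
  fixes t h :: real
  assumes "t > 0" "h > 0"
  shows "ln t \<le> (t powr h - 1) / h" "(1 - t powr (- h)) / h \<le> ln t"
proof -
  have "1 + h * ln t \<le> exp (h * ln t)" by (rule exp_ge_add_one_self)
  then show "ln t \<le> (t powr h - 1) / h" using assms by (simp add: powr_def field_simps)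
  have "1 + (- h) * ln t \<le> exp ((- h) * ln t)" by (rule exp_ge_add_one_self)
  then show "(1 - t powr (- h)) / h \<le> ln t" using assms by (simp add: powr_def field_simps)
qed

abbreviation exponential_measure :: "real measure" where
  "exponential_measure \<equiv> density lborel (exponential_density 1)"

lemma exponential_measure_powr:
  assumes "h > -1"
  shows "has_bochner_integral exponential_measure (\<lambda>t. t powr h) (Gamma (1 + h))"
proof -
  have "has_bochner_integral lborel (\<lambda>t. indicator {0..} t * t powr h / exp t) (Gamma (1 + h))"
  proof (rule has_bochner_integral_nn_integral)
    show "(\<integral>\<^sup>+ t. ennreal (indicator {0..} t * t powr h / exp t) \<partial>lborel) = ennreal (Gamma (1 + h))"
      using Gamma_conv_nn_integral_real[of "1 + h"] assms by simp
    show "0 \<le> Gamma (1 + h)" using assms by (simp add: Gamma_real_pos less_imp_le)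
  qed auto
  also have "(\<lambda>t. indicator {0..} t * t powr h / exp t) = (\<lambda>t. exponential_density 1 t *\<^sub>R t powr h)"
    by (auto simp: fun_eq_iff exponential_density_def exp_minus field_simps indicator_def)
  finally show ?thesis
    by (subst has_bochner_integral_density) (auto simp: exponential_density_nonneg)
qed

lemma AE_exponential_measure_pos: "AE t in exponential_measure. t > 0"
proof -
  have "AE t in lborel. t \<noteq> (0::real)" by (rule AE_lborel_singleton)
  then show ?thesis
    by (subst AE_density) (auto simp: exponential_density_def elim!: eventually_mono)
qed

text \<open>Both bounds on \<open>ln t\<close> integrate to difference quotients of the Gamma function at 1.\<close>

lemma exponential_measure_ln:
  "has_bochner_integral exponential_measure ln (- euler_mascheroni)"
proof -
  interpret E: prob_space exponential_measure
    by (rule prob_space_exponential_density) simp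
  have P: "integrable exponential_measure (\<lambda>t. t powr h)"
     "(\<integral>t. t powr h \<partial>exponential_measure) = Gamma (1 + h)" if "h > -1" for h
    using exponential_measure_powr[OF that] by (auto simp: has_bochner_integral_iff)
  have int: "integrable exponential_measure ln"
  proof (rule Bochner_Integration.integrable_bound)
    \<comment> \<open>The power bounds with h = 1 and h = 1/2 give ln t <= t - 1 and - ln t <= 2
      t^(-1/2) - 2; the 3 is slack that lets one function dominate both.\<close>
    show "integrable exponential_measure (\<lambda>t. t powr 1 + 2 * t powr (-1/2) + 3)"
      using P(1)[of 1] P(1)[of "-1/2"] by auto
    show "AE t in exponential_measure. norm (ln t) \<le> norm (t powr 1 + 2 * t powr (-1/2) + 3)"
    proof (rule AE_mp[OF AE_exponential_measure_pos], intro AE_I2 impI)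
      fix t :: real assume t: "t > 0"
      then show "norm (ln t) \<le> norm (t powr 1 + 2 * t powr (-1/2) + 3)"
        using ln_between_powr(1)[OF t, of 1] ln_between_powr(2)[OF t, of "1/2"]
          powr_ge_zero[of t "-1/2"]
        by (simp add: abs_le_iff del: powr_ge_zero)
    qed
  qed simp
  let ?e = "\<integral>t. ln t \<partial>exponential_measure"
  have up: "?e \<le> (Gamma (1 + h) - Gamma 1) / h" if "h > 0" for h :: real
  proof -
    have "?e \<le> (\<integral>t. (t powr h - 1) / h \<partial>exponential_measure)"
      using int P(1)[of h] that AE_exponential_measure_pos ln_between_powr(1)
      by (intro integral_mono_AE) (auto elim!: eventually_mono)
    also have "\<dots> = (Gamma (1 + h) - Gamma 1) / h"
      using P[of h] that E.prob_space by simp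
    finally show ?thesis .
  qed
  have lo: "(Gamma (1 + h) - Gamma 1) / h \<le> ?e" if "-1 < h" "h < 0" for h :: real
  proof -
    have "(Gamma (1 + h) - Gamma 1) / h = (\<integral>t. (1 - t powr h) / (-h) \<partial>exponential_measure)"
      using P[of h] that E.prob_space by (simp add: field_simps)
    also have "\<dots> \<le> ?e"
      using int P(1)[of h] that AE_exponential_measure_pos ln_between_powr(2)[of _ "-h"]
      by (intro integral_mono_AE) (auto elim!: eventually_mono)
    finally show ?thesis .
  qed
  \<comment> \<open>The derivative of Gamma at 1 is \<open>- euler_mascheroni\<close>. Quotients
    from the right bound the mean from above, those from the left from below, and both converge to
    this value.\<close>
  have D: "((\<lambda>h. (Gamma (1 + h) - Gamma 1) / h) \<longlongrightarrow> - euler_mascheroni) (at (0::real))"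
    using has_field_derivative_Gamma[of "1::real" UNIV] by (auto simp: DERIV_def)
  then have D': "((\<lambda>h. (Gamma (1 + h) - Gamma 1) / h) \<longlongrightarrow> - euler_mascheroni) (at_right (0::real))"
    "((\<lambda>h. (Gamma (1 + h) - Gamma 1) / h) \<longlongrightarrow> - euler_mascheroni) (at_left (0::real))"
    by (auto simp: filterlim_at_split)
  have "?e \<le> - euler_mascheroni"
    by (rule tendsto_lowerbound[OF D'(1) eventually_mono[OF eventually_at_right_less up]]) auto
  moreover have "- euler_mascheroni \<le> ?e"
    by (rule tendsto_upperbound[OF D'(2) eventually_mono[OF eventually_at_left_real[of "-1"] lo]]) auto
  ultimately show ?thesis using int by (simp add: has_bochner_integral_iff)
qed

text \<open>Convergence of n p forces p to 0, so ln (1 - p) differs from - p by at most 2 p^2, and n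
  p^2 = (n p) p vanishes in the limit.\<close>

lemma power_tendsto_exp_minus:
  fixes p :: "nat \<Rightarrow> real"
  assumes np: "(\<lambda>n. real n * p n) \<longlonglongrightarrow> a"
  shows "(\<lambda>n. (1 - p n) ^ n) \<longlonglongrightarrow> exp (- a)"
proof -
  have p0: "p \<longlonglongrightarrow> 0"
  proof -
    have "(\<lambda>n. (real n * p n) * (1 / real n)) \<longlonglongrightarrow> a * 0"
      by (intro tendsto_mult np) real_asymp
    moreover have "\<forall>\<^sub>F n in sequentially. (real n * p n) * (1 / real n) = p n"
      using eventually_gt_at_top[of 0] by eventually_elim auto
    ultimately show ?thesis by (auto elim: Lim_transform_eventually)
  qed
  have small: "\<forall>\<^sub>F n in sequentially. \<bar>p n\<bar> < 1/2"
    using tendstoD[OF p0, of "1/2"] by simp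
  have "(\<lambda>n. real n * ln (1 - p n)) \<longlonglongrightarrow> - a"
  proof (rule Lim_transform)
    show "(\<lambda>n. - (real n * p n)) \<longlonglongrightarrow> - a" by (intro tendsto_intros np)
    show "(\<lambda>n. real n * ln (1 - p n) - - (real n * p n)) \<longlonglongrightarrow> 0"
    proof (rule Lim_null_comparison)
      have "\<forall>\<^sub>F n in sequentially. \<bar>ln (1 + - p n) - - p n\<bar> \<le> 2 * (- p n)\<^sup>2"
        using small by eventually_elim (rule abs_ln_one_plus_x_minus_x_bound, simp)
      then show "\<forall>\<^sub>F n in sequentially. norm (real n * ln (1 - p n) - - (real n * p n)) \<le> 2 * (\<bar>real n * p n\<bar> * \<bar>p n\<bar>)"
      proof eventually_elim
        case (elim n)
        have "norm (real n * ln (1 - p n) - - (real n * p n)) = real n * \<bar>ln (1 + - p n) - - p n\<bar>"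
        proof -
          have "real n * ln (1 - p n) - - (real n * p n) = real n * (ln (1 + - p n) - - p n)"
            by (simp add: algebra_simps)
          then show ?thesis by (simp only: real_norm_def abs_minus_cancel abs_mult abs_of_nat)
        qed
        also have "\<dots> \<le> real n * (2 * (- p n)\<^sup>2)" by (intro mult_left_mono elim) auto
        also have "\<dots> = 2 * (\<bar>real n * p n\<bar> * \<bar>p n\<bar>)" by (simp add: abs_mult power2_eq_square)
        finally show ?case .
      qed
      have "(\<lambda>n. 2 * (\<bar>real n * p n\<bar> * \<bar>p n\<bar>)) \<longlonglongrightarrow> 2 * (\<bar>a\<bar> * \<bar>0\<bar>)"
        by (intro tendsto_intros np p0)
      then show "(\<lambda>n. 2 * (\<bar>real n * p n\<bar> * \<bar>p n\<bar>)) \<longlonglongrightarrow> 0" by simp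
    qed
  qed
  then have "(\<lambda>n. exp (real n * ln (1 - p n))) \<longlonglongrightarrow> exp (- a)" by (intro tendsto_intros)
  moreover have "\<forall>\<^sub>F n in sequentially. exp (real n * ln (1 - p n)) = (1 - p n) ^ n"
    using small by eventually_elim (auto simp: exp_of_nat_mult)
  ultimately show ?thesis by (auto elim: Lim_transform_eventually)
qed

section \<open>Densities between Gaussian bounds\<close>

lemma integrable_exp_minus_square:
  fixes a :: real assumes "a > 0"
  shows "integrable lborel (\<lambda>x::real. exp (- a * x\<^sup>2))"
proof -
  define \<sigma> where "\<sigma> = 1 / sqrt (2 * a)"
  have s: "\<sigma> > 0" "2 * \<sigma>\<^sup>2 = 1 / a" using assms by (auto simp: \<sigma>_def power_divide)
  have "integrable lborel (\<lambda>x. sqrt (2 * pi * \<sigma>\<^sup>2) * normal_density 0 \<sigma> x)"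
    using s by (intro integrable_mult_right integrable_normal_density) auto
  also have "(\<lambda>x. sqrt (2 * pi * \<sigma>\<^sup>2) * normal_density 0 \<sigma> x) = (\<lambda>x. exp (- a * x\<^sup>2))"
    using s by (auto simp: normal_density_def fun_eq_iff)
  finally show ?thesis .
qed

lemma integrable_exp_minus_norm_square:
  fixes a :: real assumes a: "a > 0"
  shows "integrable lborel (\<lambda>x::'b::euclidean_space. exp (- a * (norm x)\<^sup>2))"
proof (rule integrableI_bounded)
  have e: "exp (- a * (norm x)\<^sup>2) = (\<Prod>i\<in>Basis. exp (- a * (x \<bullet> i)\<^sup>2))" for x :: 'b
  proof -
    have "(norm x)\<^sup>2 = (\<Sum>i\<in>Basis. (x \<bullet> i)\<^sup>2)"
      by (simp add: norm_eq_sqrt_inner euclidean_inner[of x x] power2_eq_square sum_nonneg)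
    then show ?thesis by (simp add: exp_sum sum_distrib_left)
  qed
  have "(\<integral>\<^sup>+ x. ennreal (norm (exp (- a * (norm x)\<^sup>2))) \<partial>(lborel :: 'b measure))
      = (\<integral>\<^sup>+ x. (\<Prod>i\<in>Basis. ennreal (exp (- a * (x \<bullet> i)\<^sup>2))) \<partial>(lborel :: 'b measure))"
    by (intro nn_integral_cong, subst real_norm_def, subst abs_exp_cancel, subst e, subst prod_ennreal) auto
  also have "\<dots> = (\<Prod>i\<in>(Basis :: 'b set). (\<integral>\<^sup>+ x. ennreal (exp (- a * x\<^sup>2)) \<partial>lborel))"
    by (rule nn_integral_lborel_prod) auto
  also have "\<dots> < \<infinity>"
    using integrable_exp_minus_square[OF a]
    by (intro power_less_top_ennreal[THEN iffD2, of _ "DIM('b)", simplified] disjI2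
          | simp add: integrable_iff_bounded power_less_top_ennreal)+
  finally show "(\<integral>\<^sup>+ x. ennreal (norm (exp (- a * (norm x)\<^sup>2))) \<partial>(lborel :: 'b measure)) < \<infinity>" .
qed simp

lemma integrable_exp_minus_abs:
  fixes a :: real assumes a: "a > 0"
  shows "integrable lborel (\<lambda>x::real. exp (- a * \<bar>x\<bar>))"
proof -
  interpret prob_space "density lborel (exponential_density a)"
    by (rule prob_space_exponential_density) fact
  have i: "integrable lborel (exponential_density a)"
    using a emeasure_space_1
    by (intro integrableI_bounded) (auto simp: emeasure_density exponential_density_nonneg cong: nn_integral_cong)
  have i': "integrable lborel (\<lambda>x. exponential_density a (0 + (-1) * x))"
    by (rule lborel_integrable_real_affine[OF i]) simp
  show ?thesis
  proof (rule Bochner_Integration.integrable_bound)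
    \<comment> \<open>The density plus its reflection covers both half-lines. Both contribute at 0,
      so this dominates the target rather than equalling it.\<close>
    show "integrable lborel (\<lambda>x. (exponential_density a x + exponential_density a (0 + (-1) * x)) / a)"
      by (intro integrable_divide Bochner_Integration.integrable_add i i')
  qed (use a in \<open>auto simp: exponential_density_def add_divide_distrib mult.commute\<close>)
qed

text \<open>This is all that the probabilistic part uses of the Gaussian density. The upper bound
  gives boundedness and exponential moments of the squared norm, the lower bound keeps balls from
  being too light, and continuity gives the mass asymptotics of small balls at every point.\<close>

locale gaussian_bounds =
  fixes f :: "'b::euclidean_space \<Rightarrow> real" and c C b B V :: real and d :: nat
  assumes d_eq: "d = DIM('b)" and V_eq: "V = unit_ball_vol (real d)"
    and cont: "continuous_on UNIV f"
    and pos: "c > 0" "C > 0" "b > 0"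
    and lower: "\<And>y. c * exp (- C * (norm y)\<^sup>2) \<le> f y"
    and upper: "\<And>y. f y \<le> B * exp (- b * (norm y)\<^sup>2)"
    and total: "(\<integral>\<^sup>+x. ennreal (f x) \<partial>lborel) = 1"
begin

definition \<mu> :: "'b measure" where "\<mu> = density lborel (\<lambda>x. ennreal (f x))"

text \<open>The sample size is \<open>n + 2\<close>: \<open>T\<^sub>i > s\<close> means \<open>\<rho>\<^sub>i > rad n s\<close>.\<close>

definition rad :: "nat \<Rightarrow> real \<Rightarrow> real" where
  "rad n s = (exp (s - euler_mascheroni) / (real (n + 1) * V)) powr (1 / real d)"

text \<open>Around \<open>x\<close> the expected number of other points in the ball of radius
  \<open>rad n s\<close> tends to \<open>f x * exp (s - euler_mascheroni)\<close>; the integrand is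
  the Poisson probability of finding none.\<close>

definition survival :: "real \<Rightarrow> real" where
  "survival s = (\<integral>x. exp (- (f x * exp (s - euler_mascheroni))) \<partial>\<mu>)"

lemma f_measurable[measurable]: "f \<in> borel_measurable borel"
  using cont by (rule borel_measurable_continuous_onI)

lemma f_pos: "f y > 0"
  using lower[of y] pos by (smt (verit) exp_gt_zero mult_pos_pos)

lemma B_pos: "B > 0"
  using f_pos[of 0] upper[of 0] by simp

lemma f_le_B: "f y \<le> B"
proof -
  have "exp (- b * (norm y)\<^sup>2) \<le> 1" using pos by simp
  then have "B * exp (- b * (norm y)\<^sup>2) \<le> B * 1" using B_pos by (intro mult_left_mono) auto
  with upper[of y] show ?thesis by simp
qed

lemma sets_mu[simp, measurable_cong]: "sets \<mu> = sets borel" by (simp add: \<mu>_def)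
lemma space_mu[simp]: "space \<mu> = UNIV" by (simp add: \<mu>_def)

lemma prob_space_mu: "prob_space \<mu>"
  by (rule prob_spaceI) (simp add: \<mu>_def emeasure_density total)

sublocale mu: prob_space \<mu> by (rule prob_space_mu)
sublocale mm: pair_prob_space \<mu> \<mu> ..

lemma V_pos: "V > 0" by (simp add: V_eq)
lemma d_pos: "d > 0" by (simp add: d_eq)

lemma emeasure_mu_cball:
  "emeasure \<mu> (cball x r) = (\<integral>\<^sup>+z. ennreal (f z) * indicator (cball x r) z \<partial>lborel)"
  by (simp add: \<mu>_def emeasure_density)

section \<open>Masses of balls and exponential moments\<close>

lemma measure_mu_cball_le:
  assumes r: "r \<ge> 0" and m: "\<And>z. dist x z \<le> r \<Longrightarrow> f z \<le> m"
  shows "measure \<mu> (cball x r) \<le> m * (V * r ^ d)"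
proof -
  have m0: "m \<ge> 0" using m[of x] f_pos[of x] r by simp
  have "emeasure \<mu> (cball x r) \<le> (\<integral>\<^sup>+z. ennreal m * indicator (cball x r) z \<partial>lborel)"
    unfolding emeasure_mu_cball using m
    by (intro nn_integral_mono) (auto simp: indicator_def intro!: ennreal_leI)
  also have "\<dots> = ennreal (m * (V * r ^ d))"
    using r m0 by (simp add: nn_integral_cmult_indicator emeasure_cball ennreal_mult' V_eq d_eq)
  finally show ?thesis
    using m0 r V_pos by (simp add: mu.emeasure_eq_measure)
qed

lemma measure_mu_cball_ge:
  assumes r: "r \<ge> 0" and m0: "m \<ge> 0" and m: "\<And>z. dist x z \<le> r \<Longrightarrow> m \<le> f z"
  shows "m * (V * r ^ d) \<le> measure \<mu> (cball x r)"
proof -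
  have "ennreal (m * (V * r ^ d)) = (\<integral>\<^sup>+z. ennreal m * indicator (cball x r) z \<partial>lborel)"
    using r m0 by (simp add: nn_integral_cmult_indicator emeasure_cball ennreal_mult' V_eq d_eq)
  also have "\<dots> \<le> emeasure \<mu> (cball x r)"
    unfolding emeasure_mu_cball using m
    by (intro nn_integral_mono) (auto simp: indicator_def intro!: ennreal_leI)
  finally show ?thesis by (simp add: mu.emeasure_eq_measure)
qed

lemma integrable_mu_iff:
  "g \<in> borel_measurable borel \<Longrightarrow> integrable \<mu> g \<longleftrightarrow> integrable lborel (\<lambda>x. f x * g x :: real)"
  unfolding \<mu>_def using f_pos by (subst integrable_density) (auto intro: less_imp_le)

text \<open>Half of the decay rate \<open>b\<close> pays for the weight, the other half keeps the
  integral finite. This moment controls both the remote sample points and the growth of the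
  logarithm of \<open>f\<close>.\<close>

lemma exp_moment: "integrable \<mu> (\<lambda>x. exp (b / 2 * (norm x)\<^sup>2))"
proof (subst integrable_mu_iff)
  show "integrable lborel (\<lambda>x. f x * exp (b / 2 * (norm x)\<^sup>2))"
  proof (rule Bochner_Integration.integrable_bound)
    show "integrable lborel (\<lambda>x::'b. B * exp (- (b / 2) * (norm x)\<^sup>2))"
      using integrable_exp_minus_norm_square[of "b/2"] pos by auto
    show "AE x in lborel. norm (f x * exp (b / 2 * (norm x)\<^sup>2)) \<le> norm (B * exp (- (b / 2) * (norm x)\<^sup>2))"
    proof (rule AE_I2)
      fix x
      have "f x * exp (b / 2 * (norm x)\<^sup>2) \<le> (B * exp (- b * (norm x)\<^sup>2)) * exp (b / 2 * (norm x)\<^sup>2)"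
        using upper[of x] by (intro mult_right_mono) auto
      also have "\<dots> = B * exp (- (b / 2) * (norm x)\<^sup>2)"
        by (simp add: mult.assoc flip: exp_add)
      finally show "norm (f x * exp (b / 2 * (norm x)\<^sup>2)) \<le> norm (B * exp (- (b / 2) * (norm x)\<^sup>2))"
        using f_pos[of x] B_pos by (simp add: abs_mult)
    qed
  qed simp
qed simp

lemma rad_pos: "rad n s > 0"
  using V_pos by (simp add: rad_def)

lemma rad_power: "real (n + 1) * (V * rad n s ^ d) = exp (s - euler_mascheroni)"
proof -
  have "rad n s ^ d = exp (s - euler_mascheroni) / (real (n + 1) * V)"
    using V_pos d_pos unfolding rad_def by (subst powr_realpow[symmetric]) (auto simp: powr_powr)
  then have "real (n + 1) * (V * rad n s ^ d) = (real (n + 1) * V) * (exp (s - euler_mascheroni) / (real (n + 1) * V))"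
    by (simp only: mult.assoc)
  also have "\<dots> = exp (s - euler_mascheroni)" using V_pos by simp
  finally show ?thesis .
qed

lemma rad_tendsto_0: "(\<lambda>n. rad n s) \<longlonglongrightarrow> 0"
proof -
  have "(\<lambda>n. exp (s - euler_mascheroni) / V * (1 / real (n + 1))) \<longlonglongrightarrow> exp (s - euler_mascheroni) / V * 0"
    by (intro tendsto_mult tendsto_const) real_asymp
  then have "(\<lambda>n. exp (s - euler_mascheroni) / (real (n + 1) * V)) \<longlonglongrightarrow> 0" by (simp add: field_simps)
  then have "(\<lambda>n. (exp (s - euler_mascheroni) / (real (n + 1) * V)) powr (1 / real d)) \<longlonglongrightarrow> 0 powr (1 / real d)"
    by (intro tendsto_powr2) (use V_pos d_pos in \<open>auto intro!: always_eventually\<close>)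
  then show ?thesis by (simp add: rad_def)
qed

lemma measure_cball_rad_tendsto:
  "(\<lambda>n. real n * measure \<mu> (cball x (rad n s))) \<longlonglongrightarrow> f x * exp (s - euler_mascheroni)"
proof -
  let ?v = "\<lambda>n. V * rad n s ^ d"
  have vpos: "?v n > 0" for n using rad_pos[of n s] V_pos by simp
  have "(\<lambda>n. measure \<mu> (cball x (rad n s)) / ?v n) \<longlonglongrightarrow> f x"
  proof (rule LIMSEQ_I)
    fix e :: real assume e: "e > 0"
    have "isCont f x" using cont by (simp add: continuous_on_eq_continuous_at)
    \<comment> \<open>Taking the minimum with \<open>f x\<close> keeps
      \<open>f x - min (e / 2) (f x)\<close> nonnegative, as the lower mass bound
      \<open>measure_mu_cball_ge\<close> demands.\<close>
    then obtain \<delta> where \<delta>: "\<delta> > 0" "\<And>z. dist z x < \<delta> \<Longrightarrow> dist (f z) (f x) < min (e / 2) (f x)"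
      using e f_pos[of x] by (metis continuous_at_eps_delta half_gt_zero min_less_iff_conj)
    have "\<forall>\<^sub>F n in sequentially. rad n s < \<delta>"
      using order_tendstoD(2)[OF rad_tendsto_0 \<delta>(1)] .
    then obtain n0 where n0: "\<And>n. n \<ge> n0 \<Longrightarrow> rad n s < \<delta>" by (auto simp: eventually_sequentially)
    show "\<exists>no. \<forall>n\<ge>no. norm (measure \<mu> (cball x (rad n s)) / ?v n - f x) < e"
    proof (intro exI allI impI)
      fix n assume "n \<ge> n0"
      then have z: "\<bar>f z - f x\<bar> < min (e / 2) (f x)" if "dist x z \<le> rad n s" for z
        using \<delta>(2)[of z] n0[of n] that by (simp add: dist_commute dist_real_def abs_minus_commute)
      have zz: "f z \<le> f x + min (e / 2) (f x)" "f x - min (e / 2) (f x) \<le> f z" if "dist x z \<le> rad n s" for z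
        using z[OF that] by linarith+
      have "measure \<mu> (cball x (rad n s)) \<le> (f x + min (e / 2) (f x)) * ?v n"
        using rad_pos[of n s] by (intro measure_mu_cball_le zz) auto
      moreover have "(f x - min (e / 2) (f x)) * ?v n \<le> measure \<mu> (cball x (rad n s))"
        using rad_pos[of n s] by (intro measure_mu_cball_ge zz) auto
      ultimately have "measure \<mu> (cball x (rad n s)) / ?v n \<le> f x + min (e / 2) (f x)"
          "f x - min (e / 2) (f x) \<le> measure \<mu> (cball x (rad n s)) / ?v n"
        using vpos[of n] by (simp_all only: pos_divide_le_eq pos_le_divide_eq)
      then have "\<bar>measure \<mu> (cball x (rad n s)) / ?v n - f x\<bar> \<le> min (e / 2) (f x)" by linarith
      with e show "norm (measure \<mu> (cball x (rad n s)) / ?v n - f x) < e" by simp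
    qed
  qed
  \<comment> \<open>\<open>rad\<close> is normalised by N - 1 = n + 1, whereas n points are left
    once the pair is fixed; the quotient is harmless in the limit.\<close>
  moreover have "(\<lambda>n. real n / real (n + 1)) \<longlonglongrightarrow> 1" by real_asymp
  ultimately have "(\<lambda>n. (measure \<mu> (cball x (rad n s)) / ?v n) * (real n / real (n + 1)) * exp (s - euler_mascheroni))
      \<longlonglongrightarrow> f x * 1 * exp (s - euler_mascheroni)"
    by (intro tendsto_intros)
  moreover have "(measure \<mu> (cball x (rad n s)) / ?v n) * (real n / real (n + 1)) * exp (s - euler_mascheroni)
      = real n * measure \<mu> (cball x (rad n s))" for n
  proof -
    have "(m / v) * (k / l) * (l * v) = k * m" if "v > 0" "l > 0" for m v k l :: real
      using that by simp
    from this[OF vpos[of n], of "real (n + 1)"] show ?thesis by (simp only: rad_power)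
  qed
  ultimately show ?thesis by simp
qed

section \<open>Limits of the avoidance probabilities\<close>

lemma AE_pair_neq: "AE p in \<mu> \<Otimes>\<^sub>M \<mu>. fst p \<noteq> snd p"
proof -
  have "AE y in \<mu>. x \<noteq> y" for x
    unfolding \<mu>_def by (subst AE_density) (use AE_lborel_singleton[of x] in \<open>auto elim!: eventually_mono\<close>)
  then show ?thesis
  proof (intro mm.AE_pair_measure)
    have "{p \<in> space (\<mu> \<Otimes>\<^sub>M \<mu>). dist (fst p) (snd p) \<noteq> 0} \<in> sets (\<mu> \<Otimes>\<^sub>M \<mu>)" by measurable
    then show "{p \<in> space (\<mu> \<Otimes>\<^sub>M \<mu>). fst p \<noteq> snd p} \<in> sets (\<mu> \<Otimes>\<^sub>M \<mu>)" by simp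
  qed auto
qed

lemma avoid2_measurable:
  "(\<lambda>p. indicator {p. max r t < dist (fst p) (snd p)} p
     * (1 - measure \<mu> (cball (fst p) r \<union> cball (snd p) t)) ^ n) \<in> borel_measurable (\<mu> \<Otimes>\<^sub>M \<mu>)"
proof -
  note [measurable] = measurable_measure_cball_Un[OF prob_space_mu sets_mu]
  have "(\<lambda>p::'b\<times>'b. indicator {p. max r t < dist (fst p) (snd p)} p) = (\<lambda>p. if max r t < dist (fst p) (snd p) then 1 else 0::real)"
    by (auto simp: indicator_def)
  also have "\<dots> \<in> borel_measurable (\<mu> \<Otimes>\<^sub>M \<mu>)" by measurable
  finally have [measurable]: "indicat_real {p::'b\<times>'b. max r t < dist (fst p) (snd p)} \<in> borel_measurable (\<mu> \<Otimes>\<^sub>M \<mu>)" .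
  show ?thesis by measurable
qed

lemma avoid2_bounds:
  "0 \<le> indicator {p. max r t < dist (fst p) (snd p)} p * (1 - measure \<mu> (cball (fst p) r \<union> cball (snd p) t)) ^ n"
  "indicator {p. max r t < dist (fst p) (snd p)} p * (1 - measure \<mu> (cball (fst p) r \<union> cball (snd p) t)) ^ n \<le> (1::real)"
  by (auto simp: indicator_def power_le_one)

lemma avoid2_abs_le_1:
  "norm (indicator {p. max r t < dist (fst p) (snd p)} p
     * (1 - measure \<mu> (cball (fst p) r \<union> cball (snd p) t)) ^ n) \<le> (1::real)"
  using avoid2_bounds[of r t p n] unfolding real_norm_def by linarith

lemma avoid2_integrable:
  "integrable (\<mu> \<Otimes>\<^sub>M \<mu>) (\<lambda>p. indicator {p. max r t < dist (fst p) (snd p)} p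
     * (1 - measure \<mu> (cball (fst p) r \<union> cball (snd p) t)) ^ n)"
  by (rule mm.P.integrable_const_bound[OF AE_I2 avoid2_measurable]) (rule avoid2_abs_le_1)

lemma integrable_pair_product:
  fixes g h :: "'b \<Rightarrow> real"
  assumes g: "integrable \<mu> g" and h: "integrable \<mu> h"
  shows "integrable (\<mu> \<Otimes>\<^sub>M \<mu>) (\<lambda>p. g (fst p) * h (snd p))"
    and "(\<integral>p. g (fst p) * h (snd p) \<partial>(\<mu> \<Otimes>\<^sub>M \<mu>)) = (\<integral>x. g x \<partial>\<mu>) * (\<integral>x. h x \<partial>\<mu>)"
proof -
  have [measurable]: "g \<in> borel_measurable borel" "h \<in> borel_measurable borel"
    using g h by (auto dest: borel_measurable_integrable)
  show int: "integrable (\<mu> \<Otimes>\<^sub>M \<mu>) (\<lambda>p. g (fst p) * h (snd p))"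
    by (rule mm.Fubini_integrable) (use g h in \<open>auto simp: abs_mult\<close>)
  show "(\<integral>p. g (fst p) * h (snd p) \<partial>(\<mu> \<Otimes>\<^sub>M \<mu>)) = (\<integral>x. g x \<partial>\<mu>) * (\<integral>x. h x \<partial>\<mu>)"
    using mm.integral_fst'[OF int] by simp
qed

text \<open>For distinct points the shrinking balls are eventually disjoint and the indicator is 1,
  so the masses add and the power tends to a product of exponentials. The radii need only be
  eventually below every positive number; the constant -1 qualifies, so marginals are covered with
  \<beta> = 0.\<close>

lemma avoid2_tendsto:
  assumes r: "\<And>\<delta>. \<delta> > 0 \<Longrightarrow> \<forall>\<^sub>F n in sequentially. r n < \<delta>"
    and t: "\<And>\<delta>. \<delta> > 0 \<Longrightarrow> \<forall>\<^sub>F n in sequentially. t n < \<delta>"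
    and \<alpha>: "\<And>x. (\<lambda>n. real n * measure \<mu> (cball x (r n))) \<longlonglongrightarrow> \<alpha> x"
    and \<beta>: "\<And>x. (\<lambda>n. real n * measure \<mu> (cball x (t n))) \<longlonglongrightarrow> \<beta> x"
    and [measurable]: "\<alpha> \<in> borel_measurable borel" "\<beta> \<in> borel_measurable borel"
    and pos: "\<And>x. \<alpha> x \<ge> 0" "\<And>x. \<beta> x \<ge> 0"
  shows "(\<lambda>n. avoid2 \<mu> n (r n) (t n)) \<longlonglongrightarrow> (\<integral>x. exp (- \<alpha> x) \<partial>\<mu>) * (\<integral>x. exp (- \<beta> x) \<partial>\<mu>)"
proof -
  have ab: "integrable \<mu> (\<lambda>x. exp (- \<alpha> x))" "integrable \<mu> (\<lambda>x. exp (- \<beta> x))"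
    using pos by (auto intro!: mu.integrable_const_bound[where B=1])
  have "(\<lambda>n. avoid2 \<mu> n (r n) (t n)) \<longlonglongrightarrow> (\<integral>p. exp (- \<alpha> (fst p)) * exp (- \<beta> (snd p)) \<partial>(\<mu> \<Otimes>\<^sub>M \<mu>))"
    unfolding avoid2_def
  proof (rule integral_dominated_convergence[where w="\<lambda>_. 1"])
    show "AE p in \<mu> \<Otimes>\<^sub>M \<mu>. (\<lambda>n. indicator {p. max (r n) (t n) < dist (fst p) (snd p)} p
       * (1 - measure \<mu> (cball (fst p) (r n) \<union> cball (snd p) (t n))) ^ n)
       \<longlonglongrightarrow> exp (- \<alpha> (fst p)) * exp (- \<beta> (snd p))"
      using AE_pair_neq
    proof eventually_elim
      case (elim p)
      obtain x y where p: "p = (x, y)" and xy: "dist x y > 0" using elim by (cases p) auto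
      have ev: "\<forall>\<^sub>F n in sequentially. r n < dist x y / 2 \<and> t n < dist x y / 2"
        using xy by (intro eventually_conj r t) auto
      have "(\<lambda>n. (1 - (measure \<mu> (cball x (r n)) + measure \<mu> (cball y (t n)))) ^ n) \<longlonglongrightarrow> exp (- (\<alpha> x + \<beta> y))"
        by (rule power_tendsto_exp_minus) (auto simp: distrib_left intro!: tendsto_intros \<alpha> \<beta>)
      then have "(\<lambda>n. (1 - (measure \<mu> (cball x (r n)) + measure \<mu> (cball y (t n)))) ^ n) \<longlonglongrightarrow> exp (- \<alpha> x) * exp (- \<beta> y)"
        by (simp add: exp_add[symmetric])
      moreover have "\<forall>\<^sub>F n in sequentially. (1 - (measure \<mu> (cball x (r n)) + measure \<mu> (cball y (t n)))) ^ n
         = indicator {p. max (r n) (t n) < dist (fst p) (snd p)} p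
           * (1 - measure \<mu> (cball (fst p) (r n) \<union> cball (snd p) (t n))) ^ n"
        using ev
      proof eventually_elim
        case (elim n)
        have "cball x (r n) \<inter> cball y (t n) = {}"
        proof (safe, goal_cases)
          case (1 z)
          then show ?case using elim dist_triangle2[of x y z] by (simp add: dist_commute)
        qed
        then have "measure \<mu> (cball x (r n) \<union> cball y (t n)) = measure \<mu> (cball x (r n)) + measure \<mu> (cball y (t n))"
          by (intro mu.finite_measure_Union) auto
        moreover have "max (r n) (t n) < dist x y" using elim xy unfolding max_less_iff_conj by linarith
        ultimately show ?case by (simp add: p)
      qed
      ultimately show ?case unfolding p by (auto elim: Lim_transform_eventually)
    qed
    show "(\<lambda>p. exp (- \<alpha> (fst p)) * exp (- \<beta> (snd p))) \<in> borel_measurable (\<mu> \<Otimes>\<^sub>M \<mu>)"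
      by measurable
    show "AE p in \<mu> \<Otimes>\<^sub>M \<mu>. norm (indicator {p. max (r n) (t n) < dist (fst p) (snd p)} p
       * (1 - measure \<mu> (cball (fst p) (r n) \<union> cball (snd p) (t n))) ^ n) \<le> 1" for n
      by (rule AE_I2) (rule avoid2_abs_le_1)
  qed (rule avoid2_measurable mm.P.integrable_const)+
  then show ?thesis using integrable_pair_product(2)[OF ab] by simp
qed

lemma avoid2_pair_tendsto:
  "(\<lambda>n. avoid2 \<mu> n (rad n s) (rad n t)) \<longlonglongrightarrow> survival s * survival t"
  unfolding survival_def
  by (rule avoid2_tendsto)
     (auto intro!: measure_cball_rad_tendsto order_tendstoD(2)[OF rad_tendsto_0] mult_nonneg_nonneg less_imp_le[OF f_pos])

lemma avoid2_single_tendsto: "(\<lambda>n. avoid2 \<mu> n (rad n s) (-1)) \<longlonglongrightarrow> survival s"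
proof -
  have "(\<lambda>n. avoid2 \<mu> n (rad n s) (-1)) \<longlonglongrightarrow> survival s * (\<integral>x. exp (- 0) \<partial>\<mu>)"
    unfolding survival_def
    by (rule avoid2_tendsto)
       (auto intro!: measure_cball_rad_tendsto order_tendstoD(2)[OF rad_tendsto_0] mult_nonneg_nonneg less_imp_le[OF f_pos])
  then show ?thesis using mu.prob_space by simp
qed

lemma survival_measurable[measurable]: "survival \<in> borel_measurable borel"
proof -
  have "(\<lambda>(s, x). exp (- (f x * exp (s - euler_mascheroni)))) \<in> borel_measurable (borel \<Otimes>\<^sub>M \<mu>)"
    unfolding split_beta' by measurable
  from mu.borel_measurable_lebesgue_integral[OF this] show ?thesis
    by (simp add: survival_def[abs_def])
qed

end

lemma exponential_measure_greaterThan: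
  assumes a: "a \<ge> 0"
  shows "measure exponential_measure {a<..} = exp (- a)"
proof -
  interpret E: prob_space exponential_measure
    by (rule prob_space_exponential_density) simp
  have "distributed exponential_measure lborel (\<lambda>x. x) (exponential_density 1)"
    by (auto simp: distributed_def exponential_density_nonneg intro!: distr_id2)
  from E.exponential_distributedD_gt[OF this a] show ?thesis
    by (simp add: greaterThan_def)
qed

section \<open>Tail bounds uniform in the sample size\<close>

context gaussian_bounds begin

text \<open>A union bound over the n + 1 other points, carried out under the integral: the second
  point of the pair contributes \<open>?I\<close>, and Bernoulli's inequality accounts for the
  remaining n. At radius 0 it also excludes coincident points almost surely.\<close>

lemma avoid2_lower_tail:
  assumes r: "r \<ge> 0"
  shows "1 - avoid2 \<mu> n r (-1) \<le> real (n + 1) * (B * (V * r ^ d))"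
proof -
  let ?p = "\<lambda>x. measure \<mu> (cball x r)"
  let ?I = "\<lambda>p. indicator {p. dist (fst p) (snd p) \<le> r} p :: real"
  have p_le: "?p x \<le> B * (V * r ^ d)" for x by (rule measure_mu_cball_le[OF r f_le_B])
  have pm: "?p \<in> borel_measurable borel"
    using measurable_compose[OF _ measurable_measure_cball_Un[OF prob_space_mu sets_mu, of r "-1"], of "\<lambda>x. (x, x)" \<mu>]
    by simp
  have pint: "integrable \<mu> ?p" using pm by (intro mu.integrable_const_bound[where B=1]) auto
  have Im: "?I \<in> borel_measurable (\<mu> \<Otimes>\<^sub>M \<mu>)"
  proof -
    have "?I = (\<lambda>p. if dist (fst p) (snd p) \<le> r then 1 else 0)" by (auto simp: indicator_def)
    also have "\<dots> \<in> borel_measurable (\<mu> \<Otimes>\<^sub>M \<mu>)" by measurable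
    finally show ?thesis .
  qed
  have Iint: "integrable (\<mu> \<Otimes>\<^sub>M \<mu>) ?I"
    by (rule mm.P.integrable_const_bound[where B=1, OF AE_I2 Im]) (simp add: indicator_def)
  have I: "(\<integral>p. ?I p \<partial>(\<mu> \<Otimes>\<^sub>M \<mu>)) = (\<integral>x. ?p x \<partial>\<mu>)"
  proof -
    have "(\<integral>p. ?I p \<partial>(\<mu> \<Otimes>\<^sub>M \<mu>)) = (\<integral>x. \<integral>y. ?I (x, y) \<partial>\<mu> \<partial>\<mu>)"
      using mm.integral_fst'[OF Iint] by simp
    also have "\<dots> = (\<integral>x. ?p x \<partial>\<mu>)"
    proof (rule Bochner_Integration.integral_cong[OF refl])
      fix x
      have "(\<integral>y. ?I (x, y) \<partial>\<mu>) = (\<integral>y. indicator (cball x r) y \<partial>\<mu>)"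
        by (intro Bochner_Integration.integral_cong) (auto simp: indicator_def)
      then show "(\<integral>y. ?I (x, y) \<partial>\<mu>) = ?p x" by simp
    qed
    finally show ?thesis .
  qed
  have pint2: "integrable (\<mu> \<Otimes>\<^sub>M \<mu>) (\<lambda>p. ?p (fst p))" "(\<integral>p. ?p (fst p) \<partial>(\<mu> \<Otimes>\<^sub>M \<mu>)) = (\<integral>x. ?p x \<partial>\<mu>)"
    using integrable_pair_product[OF pint, of "\<lambda>_. 1"] mu.prob_space by auto
  have pw: "1 - ?I p - real n * ?p (fst p) \<le> indicator {p. max r (-1) < dist (fst p) (snd p)} p
     * (1 - measure \<mu> (cball (fst p) r \<union> cball (snd p) (-1))) ^ n" for p
  proof -
    have "1 + real n * (- ?p (fst p)) \<le> (1 + - ?p (fst p)) ^ n"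
      by (rule Bernoulli_inequality) simp
    then have "1 - real n * ?p (fst p) \<le> (1 - ?p (fst p)) ^ n" by simp
    then show ?thesis using r by (auto simp: indicator_def)
  qed
  have "1 - (\<integral>x. ?p x \<partial>\<mu>) - real n * (\<integral>x. ?p x \<partial>\<mu>) = (\<integral>p. 1 - ?I p - real n * ?p (fst p) \<partial>(\<mu> \<Otimes>\<^sub>M \<mu>))"
    using Iint pint2 I mm.P.prob_space by simp
  also have "\<dots> \<le> avoid2 \<mu> n r (-1)"
    unfolding avoid2_def
    by (rule integral_mono[OF _ avoid2_integrable pw]) (use Iint pint2 in auto)
  finally have "1 - avoid2 \<mu> n r (-1) \<le> real (n + 1) * (\<integral>x. ?p x \<partial>\<mu>)" by (simp add: algebra_simps)
  also have "(\<integral>x. ?p x \<partial>\<mu>) \<le> B * (V * r ^ d)"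
    using integral_mono[OF pint, of "\<lambda>_. B * (V * r ^ d)"] p_le mu.prob_space by simp
  finally show ?thesis by (simp add: mult_left_mono)
qed

text \<open>If the ball around x has substantial mass, then n points rarely all avoid it. If its
  mass is small although its volume is exp (s - \<gamma>) / (n + 1), the lower Gaussian bound forces
  |x|^2 + r^2 to grow with s. The surviving pairs have r < |x - y|, so then |x|^2 + |y|^2 is large,
  which is exponentially unlikely. The second case uses no power at all and so covers n = 0.\<close>

lemma avoid2_upper_tail:
  "\<exists>K \<kappa>. \<kappa> > 0 \<and> (\<forall>n s. s \<ge> 0 \<longrightarrow> avoid2 \<mu> n (rad n s) (-1) \<le> K * exp (- \<kappa> * s))"
proof -
  let ?g = "euler_mascheroni :: real"
  \<comment> \<open>The second case produces the exponent
    \<open>C * (6 * (norm x)\<^sup>2 + 6 * (norm y)\<^sup>2)\<close>. This \<eta> scales its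
    coefficients 6 C to b / 2, the rate allowed by \<open>exp_moment\<close>.\<close>
  define \<eta> where "\<eta> = b / (12 * C)"
  have \<eta>: "\<eta> > 0" "12 * C * \<eta> = b" using pos by (auto simp: \<eta>_def)
  define e2 where "e2 = (\<lambda>x::'b. exp (b / 2 * (norm x)\<^sup>2))"
  have e2: "integrable \<mu> e2" unfolding e2_def by (rule exp_moment)
  define m where "m = (\<integral>x. e2 x \<partial>\<mu>)"
  \<comment> \<open>One summand for each case of the pointwise bound. The moment is squared because
    x and y are independent under the product measure; \<kappa> below is the worse of the two decay
    rates.\<close>
  define K where "K = exp 1 + exp (\<eta> * (?g - ln c)) * m\<^sup>2"
  define \<kappa> where "\<kappa> = min (1/2) (\<eta> / 2)"
  have bound: "avoid2 \<mu> n (rad n s) (-1) \<le> K * exp (- \<kappa> * s)" if s: "s \<ge> 0" for n s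
  proof -
    let ?r = "rad n s" and ?p = "\<lambda>x. measure \<mu> (cball x (rad n s))"
    have r: "?r > 0" by (rule rad_pos)
    have pw: "indicator {p. max ?r (-1) < dist (fst p) (snd p)} p
        * (1 - measure \<mu> (cball (fst p) ?r \<union> cball (snd p) (-1))) ^ n
       \<le> exp 1 * exp (- s / 2) + exp (\<eta> * (?g - ln c)) * exp (- \<eta> * s / 2) * (e2 (fst p) * e2 (snd p))"
      (is "?lhs \<le> ?a + ?b") for p
    proof -
      obtain x y where p: "p = (x, y)" by (cases p)
      have ab: "?a \<ge> 0" "?b \<ge> 0" by (auto simp: e2_def)
      show ?thesis
      \<comment> \<open>At a typical point this quantity has order exp s. The threshold exp (s / 2)
        is large enough to make avoidance unlikely and small enough that falling below it is
        exceptional.\<close>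
      proof (cases "real (n + 1) * ?p x \<ge> exp (s / 2)")
        case True
        have "?lhs \<le> (1 - ?p x) ^ n" by (auto simp: p indicator_def)
        also have "\<dots> \<le> exp (- ?p x) ^ n"
          using exp_ge_add_one_self[of "- ?p x"] by (intro power_mono) auto
        \<comment> \<open>Only n factors are available while the threshold concerns n + 1; the
          missing factor costs at most \<open>exp 1\<close>, since a mass is at most 1.\<close>
        also have "\<dots> = exp (?p x - real (n + 1) * ?p x)"
          by (simp add: exp_of_nat_mult[symmetric] algebra_simps)
        also have "\<dots> \<le> exp (1 - s / 2)"
          using True exp_ge_add_one_self[of "s / 2"] mu.prob_le_1[of "cball x ?r"]
          unfolding exp_le_cancel_iff by linarith
        also have "\<dots> = ?a" by (simp add: exp_add[symmetric])
        finally show ?thesis using ab by linarith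
      next
        case False
        show ?thesis
        proof (cases "?r < dist x y")
          case far: True
          have ge: "c * exp (- C * (2 * (norm x)\<^sup>2 + 2 * ?r\<^sup>2)) \<le> f z" if z: "dist x z \<le> ?r" for z
          proof -
            have "norm z \<le> norm x + ?r"
              using z norm_triangle_ineq2[of z x] by (simp add: dist_norm norm_minus_commute)
            then have "(norm z)\<^sup>2 \<le> (norm x + ?r)\<^sup>2" by (intro power_mono) auto
            also have "\<dots> \<le> 2 * (norm x)\<^sup>2 + 2 * ?r\<^sup>2"
              using zero_le_power2[of "norm x - ?r"] by (simp add: power2_sum power2_diff)
            finally have "- C * (2 * (norm x)\<^sup>2 + 2 * ?r\<^sup>2) \<le> - C * (norm z)\<^sup>2"
              using pos by simp
            then have "c * exp (- C * (2 * (norm x)\<^sup>2 + 2 * ?r\<^sup>2)) \<le> c * exp (- C * (norm z)\<^sup>2)"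
              using pos by (intro mult_left_mono) auto
            with lower[of z] show ?thesis by simp
          qed
          have "c * exp (- C * (2 * (norm x)\<^sup>2 + 2 * ?r\<^sup>2)) * (V * ?r ^ d) \<le> ?p x"
            by (rule measure_mu_cball_ge[OF _ _ ge]) (use r pos in auto)
          then have "real (n + 1) * (c * exp (- C * (2 * (norm x)\<^sup>2 + 2 * ?r\<^sup>2)) * (V * ?r ^ d)) \<le> real (n + 1) * ?p x"
            by (intro mult_left_mono) auto
          also have "\<dots> < exp (s / 2)" using False by simp
          also have "real (n + 1) * (c * exp (- C * (2 * (norm x)\<^sup>2 + 2 * ?r\<^sup>2)) * (V * ?r ^ d))
              = c * exp (- C * (2 * (norm x)\<^sup>2 + 2 * ?r\<^sup>2)) * (real (n + 1) * (V * ?r ^ d))"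
            by (simp only: mult_ac)
          also have "\<dots> = exp (ln c) * exp (- C * (2 * (norm x)\<^sup>2 + 2 * ?r\<^sup>2)) * exp (s - ?g)"
            using pos by (simp only: rad_power exp_ln)
          also have "\<dots> = exp (ln c - C * (2 * (norm x)\<^sup>2 + 2 * ?r\<^sup>2) + (s - ?g))"
            by (simp flip: exp_add)
          finally have 1: "ln c - C * (2 * (norm x)\<^sup>2 + 2 * ?r\<^sup>2) + (s - ?g) < s / 2" by simp
          have "?r \<le> norm x + norm y"
            using far norm_triangle_ineq4[of x y] by (simp add: dist_norm)
          then have "?r\<^sup>2 \<le> (norm x + norm y)\<^sup>2" using r by (intro power_mono) auto
          also have "\<dots> \<le> 2 * (norm x)\<^sup>2 + 2 * (norm y)\<^sup>2"
            using zero_le_power2[of "norm x - norm y"] by (simp add: power2_sum power2_diff)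
          finally have "2 * (norm x)\<^sup>2 + 2 * ?r\<^sup>2 \<le> 6 * (norm x)\<^sup>2 + 6 * (norm y)\<^sup>2"
            using zero_le_power2[of "norm y"] zero_le_power2[of "norm x"] by linarith
          then have "C * (2 * (norm x)\<^sup>2 + 2 * ?r\<^sup>2) \<le> C * (6 * (norm x)\<^sup>2 + 6 * (norm y)\<^sup>2)"
            using pos by (intro mult_left_mono) auto
          with 1 have "0 \<le> (?g - ln c) - s / 2 + C * (6 * (norm x)\<^sup>2 + 6 * (norm y)\<^sup>2)" by linarith
          \<comment> \<open>A Chernoff argument: scaling the deterministic inequality by \<eta> and
            exponentiating gives \<open>1 <= ?b\<close>, and the left-hand side never exceeds
            1.\<close>
          then have "0 \<le> \<eta> * ((?g - ln c) - s / 2 + C * (6 * (norm x)\<^sup>2 + 6 * (norm y)\<^sup>2))"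
            using \<eta> by simp
          also have "\<dots> = \<eta> * (?g - ln c) + - \<eta> * s / 2 + ((12 * C * \<eta>) / 2 * (norm x)\<^sup>2 + (12 * C * \<eta>) / 2 * (norm y)\<^sup>2)"
            by (simp add: algebra_simps)
          finally have "exp 0 \<le> exp (\<eta> * (?g - ln c) + - \<eta> * s / 2 + (b / 2 * (norm x)\<^sup>2 + b / 2 * (norm y)\<^sup>2))"
            unfolding exp_le_cancel_iff \<eta>(2) .
          also have "\<dots> = ?b" by (simp only: exp_add e2_def p fst_conv snd_conv)
          finally have "1 \<le> ?b" by simp
          then show ?thesis using avoid2_bounds(2)[of ?r "-1" p n] ab by linarith
        next
          case False
          then have "?lhs = 0" by (simp add: p)
          then show ?thesis using ab by linarith
        qed
      qed
    qed
    note ee = integrable_pair_product[OF e2 e2]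
    have "avoid2 \<mu> n ?r (-1) \<le> (\<integral>p. exp 1 * exp (- s / 2) + exp (\<eta> * (?g - ln c)) * exp (- \<eta> * s / 2) * (e2 (fst p) * e2 (snd p)) \<partial>(\<mu> \<Otimes>\<^sub>M \<mu>))"
      unfolding avoid2_def by (rule integral_mono[OF avoid2_integrable _ pw]) (use ee in auto)
    also have "\<dots> = exp 1 * exp (- s / 2) + exp (\<eta> * (?g - ln c)) * exp (- \<eta> * s / 2) * m\<^sup>2"
      using ee mm.P.prob_space by (simp add: m_def power2_eq_square)
    also have "\<dots> \<le> exp 1 * exp (- \<kappa> * s) + exp (\<eta> * (?g - ln c)) * exp (- \<kappa> * s) * m\<^sup>2"
    proof -
      have "\<kappa> * s \<le> (1/2) * s" "\<kappa> * s \<le> (\<eta>/2) * s"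
        using s by (intro mult_right_mono; simp add: \<kappa>_def)+
      then show ?thesis by (intro add_mono mult_left_mono mult_right_mono) auto
    qed
    also have "\<dots> = K * exp (- \<kappa> * s)" by (simp add: K_def algebra_simps)
    finally show ?thesis .
  qed
  have "\<kappa> > 0" using \<eta> by (simp add: \<kappa>_def)
  with bound show ?thesis by blast
qed

lemma avoid2_tails:
  obtains q where "\<And>s. 0 \<le> q s" "integrable lborel q"
    "\<And>n s. s \<ge> 0 \<Longrightarrow> avoid2 \<mu> n (rad n s) (-1) \<le> (q s)\<^sup>2"
    "\<And>n s. s < 0 \<Longrightarrow> 1 - avoid2 \<mu> n (rad n s) (-1) \<le> (q s)\<^sup>2"
proof -
  obtain K \<kappa> where \<kappa>: "\<kappa> > 0" and up: "\<And>n s. s \<ge> 0 \<Longrightarrow> avoid2 \<mu> n (rad n s) (-1) \<le> K * exp (- \<kappa> * s)"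
    using avoid2_upper_tail by blast
  \<comment> \<open>The lower tail is linear in the volume and so decays at rate 1, the upper tail
    at rate \<kappa>; \<open>a\<close> serves both.\<close>
  define a where "a = min 1 \<kappa>"
  \<comment> \<open>The absolute value is taken because \<open>avoid2_upper_tail\<close> leaves the
    sign of \<open>K\<close> open; \<open>B * exp (- euler_mascheroni)\<close> is the constant of
    the lower tail.\<close>
  define K' where "K' = \<bar>K\<bar> + B * exp (- euler_mascheroni)"
  have K': "K' \<ge> 0" using B_pos by (simp add: K'_def)
  have a: "a > 0" using \<kappa> by (simp add: a_def)
  show ?thesis
  proof (rule that[of "\<lambda>s. sqrt K' * exp (- (a / 2) * \<bar>s\<bar>)"])
    have sq: "(sqrt K' * exp (- (a / 2) * \<bar>s\<bar>))\<^sup>2 = K' * exp (- a * \<bar>s\<bar>)" for s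
      using K' by (simp add: power_mult_distrib exp_double[symmetric])
    show "integrable lborel (\<lambda>s. sqrt K' * exp (- (a / 2) * \<bar>s\<bar>))"
      using integrable_exp_minus_abs[of "a/2"] a by (intro integrable_mult_right) auto
    show "0 \<le> sqrt K' * exp (- (a / 2) * \<bar>s\<bar>)" for s using K' by simp
    show "avoid2 \<mu> n (rad n s) (-1) \<le> (sqrt K' * exp (- (a / 2) * \<bar>s\<bar>))\<^sup>2" if s: "s \<ge> 0" for n s
    proof -
      have "avoid2 \<mu> n (rad n s) (-1) \<le> \<bar>K\<bar> * exp (- \<kappa> * s)"
        using up[OF s, of n] abs_ge_self[of K] by (smt (verit) exp_gt_zero mult_right_mono)
      also have "\<dots> \<le> K' * exp (- a * \<bar>s\<bar>)"
        using s B_pos by (intro mult_mono) (auto simp: K'_def a_def mult_right_mono)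
      finally show ?thesis by (simp only: sq)
    qed
    show "1 - avoid2 \<mu> n (rad n s) (-1) \<le> (sqrt K' * exp (- (a / 2) * \<bar>s\<bar>))\<^sup>2" if s: "s < 0" for n s
    proof -
      have "1 - avoid2 \<mu> n (rad n s) (-1) \<le> real (n + 1) * (B * (V * rad n s ^ d))"
        by (rule avoid2_lower_tail) (simp add: rad_pos less_imp_le)
      also have "\<dots> = B * (real (n + 1) * (V * rad n s ^ d))" by (simp only: mult_ac)
      also have "\<dots> = (B * exp (- euler_mascheroni)) * exp s"
        by (simp only: rad_power) (simp add: exp_diff exp_minus field_simps)
      also have "\<dots> \<le> K' * exp (- a * \<bar>s\<bar>)"
      proof (intro mult_mono)
        have "a * (-s) \<le> 1 * (-s)" using s by (intro mult_right_mono) (auto simp: a_def)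
        then show "exp s \<le> exp (- a * \<bar>s\<bar>)" using s by simp
      qed (use B_pos in \<open>auto simp: K'_def\<close>)
      finally show ?thesis by (simp only: sq)
    qed
  qed
qed

section \<open>The entropy as the mean of the limit law\<close>

lemma integrable_ln_f: "integrable \<mu> (\<lambda>x. ln (f x))"
proof (rule Bochner_Integration.integrable_bound)
  \<comment> \<open>The Gaussian bounds confine ln (f x) between ln c - C |x|^2 and ln B. The factor
    \<open>2 / b\<close> comes from u <= exp u with u = b / 2 * |x|^2.\<close>
  let ?g = "\<lambda>x::'b. (\<bar>ln c\<bar> + \<bar>ln B\<bar>) + C * (2 / b) * exp (b / 2 * (norm x)\<^sup>2)"
  show "integrable \<mu> ?g" using exp_moment by auto
  show "AE x in \<mu>. norm (ln (f x)) \<le> norm (?g x)"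
  proof (rule AE_I2)
    fix x
    have "ln (c * exp (- C * (norm x)\<^sup>2)) \<le> ln (f x)"
      using lower[of x] pos f_pos[of x] by (subst ln_le_cancel_iff) auto
    then have 1: "ln c - C * (norm x)\<^sup>2 \<le> ln (f x)" using pos by (simp add: ln_mult)
    have 2: "ln (f x) \<le> ln B" using f_le_B[of x] f_pos[of x] B_pos by (subst ln_le_cancel_iff) auto
    have "b / 2 * (norm x)\<^sup>2 \<le> exp (b / 2 * (norm x)\<^sup>2)"
      using exp_ge_add_one_self[of "b / 2 * (norm x)\<^sup>2"] by linarith
    then have "C * (2 / b) * (b / 2 * (norm x)\<^sup>2) \<le> C * (2 / b) * exp (b / 2 * (norm x)\<^sup>2)"
      using pos by (intro mult_left_mono) auto
    then have 3: "C * (norm x)\<^sup>2 \<le> C * (2 / b) * exp (b / 2 * (norm x)\<^sup>2)" using pos by simp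
    have 4: "0 \<le> C * (norm x)\<^sup>2" using pos by simp
    from 1 2 3 4 show "norm (ln (f x)) \<le> norm (?g x)" unfolding real_norm_def by linarith
  qed
qed simp

text \<open>
  The limit law of \<open>ln ((N - 1) V \<rho>\<^sup>d) + \<gamma>\<close> is that of \<open>ln e - ln (f x) + \<gamma>\<close> with \<open>x\<close> drawn from
  the density and \<open>e\<close> independent standard exponential.
\<close>

lemma integral_survival:
  "(\<integral>s. survival s - indicator {..<0} s \<partial>lborel) = - (\<integral>x. ln (f x) \<partial>\<mu>)"
proof -
  let ?g = "euler_mascheroni :: real" and ?E = "exponential_measure"
  interpret E: prob_space ?E by (rule prob_space_exponential_density) simp
  interpret P: pair_prob_space \<mu> ?E ..
  define T where "T = (\<lambda>p::'b \<times> real. ln (snd p) - ln (f (fst p)) + ?g)"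
  have i1: "integrable (\<mu> \<Otimes>\<^sub>M ?E) (\<lambda>p. ln (snd p))"
    by (rule P.Fubini_integrable)
       (use exponential_measure_ln in \<open>auto simp: has_bochner_integral_iff\<close>)
  have i2: "integrable (\<mu> \<Otimes>\<^sub>M ?E) (\<lambda>p. ln (f (fst p)))"
    by (rule P.Fubini_integrable) (use integrable_ln_f in \<open>auto simp: E.prob_space\<close>)
  have int: "integrable (\<mu> \<Otimes>\<^sub>M ?E) T" unfolding T_def using i1 i2 by auto
  have "(\<integral>p. ln (snd p) \<partial>(\<mu> \<Otimes>\<^sub>M ?E)) = - ?g"
    using P.integral_fst'[OF i1] exponential_measure_ln mu.prob_space
    by (simp add: has_bochner_integral_iff)
  moreover have "(\<integral>p. ln (f (fst p)) \<partial>(\<mu> \<Otimes>\<^sub>M ?E)) = (\<integral>x. ln (f x) \<partial>\<mu>)"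
    using P.integral_fst'[OF i2] E.prob_space by simp
  ultimately have ET: "P.P.expectation T = - (\<integral>x. ln (f x) \<partial>\<mu>)"
    unfolding T_def using i1 i2 P.P.prob_space by simp
  have surv: "P.P.prob {p\<in>space (\<mu> \<Otimes>\<^sub>M ?E). s < T p} = survival s" for s
  proof -
    let ?A = "{p\<in>space (\<mu> \<Otimes>\<^sub>M ?E). s < T p}"
    have A[measurable]: "?A \<in> sets (\<mu> \<Otimes>\<^sub>M ?E)" unfolding T_def by measurable
    have "P.P.prob ?A = (\<integral>p. indicator ?A p \<partial>(\<mu> \<Otimes>\<^sub>M ?E))" using sets.Int_space_eq2[OF A] by simp
    also have "\<dots> = (\<integral>x. \<integral>e. indicator ?A (x, e) \<partial>?E \<partial>\<mu>)"
      by (rule P.integral_fst'[symmetric], rule P.P.integrable_const_bound[where B=1])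
         (auto simp: indicator_def)
    also have "\<dots> = survival s" unfolding survival_def
    proof (rule Bochner_Integration.integral_cong[OF refl])
      fix x
      have "(\<integral>e. indicat_real ?A (x, e) \<partial>?E) = (\<integral>e. indicator {f x * exp (s - ?g)<..} e \<partial>?E)"
      proof (rule integral_cong_AE)
        show "AE e in ?E. indicator ?A (x, e) = (indicator {f x * exp (s - ?g)<..} e :: real)"
          using AE_exponential_measure_pos
        proof eventually_elim
          case (elim e)
          have "s < T (x, e) \<longleftrightarrow> ln (f x) + (s - ?g) < ln e" by (auto simp: T_def)
          also have "\<dots> \<longleftrightarrow> exp (ln (f x) + (s - ?g)) < exp (ln e)" by simp
          also have "\<dots> \<longleftrightarrow> f x * exp (s - ?g) < e" using elim f_pos[of x] by (simp only: exp_add exp_ln)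
          finally show ?case by (auto simp: indicator_def space_pair_measure)
        qed
        show "(\<lambda>e. indicat_real ?A (x, e)) \<in> borel_measurable ?E"
          by (rule measurable_compose[OF measurable_Pair1' borel_measurable_indicator[OF A]]) simp
      qed simp
      also have "\<dots> = exp (- (f x * exp (s - ?g)))"
        using exponential_measure_greaterThan[of "f x * exp (s - ?g)"] f_pos[of x] by simp
      finally show "(\<integral>e. indicator ?A (x, e) \<partial>?E) = exp (- (f x * exp (s - ?g)))" .
    qed
    finally show ?thesis .
  qed
  \<comment> \<open>The layer cake formula read backwards: \<open>survival\<close> is the tail
    function of \<open>T\<close>, so its kernel integral is the mean of \<open>T\<close>.\<close>
  show ?thesis
    using P.P.expectation_eq_integral_tail[OF int] by (simp add: surv ET has_bochner_integral_iff)
qed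

end

section \<open>Mean-square consistency\<close>

text \<open>After division the n + 2 diagonal terms weigh Q / (n + 2), while the off-diagonal ones
  keep total weight (n + 1) / (n + 2). The bound thus tends to H^2 - 2 H^2 + H^2.\<close>

lemma second_moment_mean_tendsto_0:
  fixes e1 e2 g :: "nat \<Rightarrow> real"
  assumes "e1 \<longlonglongrightarrow> H" "e2 \<longlonglongrightarrow> H\<^sup>2"
    and g0: "\<And>n. 0 \<le> g n"
    and g: "\<And>n. g n \<le> (real (n + 2) * Q + real (n + 2) * real (n + 1) * e2 n) / (real (n + 2))\<^sup>2 - 2 * H * e1 n + H\<^sup>2"
  shows "g \<longlonglongrightarrow> 0"
proof -
  have 1: "(\<lambda>n. Q * (1 / real (n + 2))) \<longlonglongrightarrow> Q * 0"
    by (intro tendsto_mult tendsto_const) real_asymp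
  have 2: "(\<lambda>n. real (n + 1) / real (n + 2)) \<longlonglongrightarrow> 1" by real_asymp
  have "(\<lambda>n. Q * (1 / real (n + 2)) + (real (n + 1) / real (n + 2)) * e2 n - 2 * H * e1 n + H\<^sup>2)
      \<longlonglongrightarrow> Q * 0 + 1 * H\<^sup>2 - 2 * H * H + H\<^sup>2"
    by (intro tendsto_intros 1 2 assms)
  then have lim: "(\<lambda>n. Q * (1 / real (n + 2)) + (real (n + 1) / real (n + 2)) * e2 n - 2 * H * e1 n + H\<^sup>2) \<longlonglongrightarrow> 0"
    by (simp add: power2_eq_square)
  have "(m * Q + m * k * e) / m\<^sup>2 = Q * (1 / m) + k / m * e" if "m > 0" for m k e :: real
    using that by (simp add: power2_eq_square field_simps)
  from this[of "real (_ + 2)"] have "g n \<le> Q * (1 / real (n + 2)) + (real (n + 1) / real (n + 2)) * e2 n - 2 * H * e1 n + H\<^sup>2" for n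
    using g[of n] by simp
  then show ?thesis
    by (intro tendsto_sandwich[OF _ _ tendsto_const lim]) (auto simp: g0)
qed

lemma measurable_nn_dist:
  fixes X :: "nat \<Rightarrow> 'a \<Rightarrow> 'b::euclidean_space"
  assumes X: "\<And>k. k \<ge> 1 \<Longrightarrow> X k \<in> borel_measurable M" and i: "i \<in> {1..N}"
  shows "(\<lambda>\<omega>. nn_dist (\<lambda>k. X k \<omega>) N i) \<in> borel_measurable M"
  unfolding nn_dist_def
  by (rule borel_measurable_Min) (use X i in \<open>auto intro!: borel_measurable_dist\<close>)

section \<open>Logarithmic volumes of the nearest-neighbour balls\<close>

context gaussian_bounds begin

definition log_vol :: "(nat \<Rightarrow> 'b) \<Rightarrow> nat \<Rightarrow> nat \<Rightarrow> real" where
  "log_vol x N i = real d * ln (nn_dist x N i) + ln V + euler_mascheroni + ln (real N - 1)"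

text \<open>\<open>rad n\<close> inverts the increasing map from a radius to its logarithmic volume.
  Positivity rules out a coincidence, where \<open>ln 0 = 0\<close> would break the
  monotonicity.\<close>

lemma less_log_vol_iff:
  assumes "nn_dist x (n + 2) i > 0"
  shows "s < log_vol x (n + 2) i \<longleftrightarrow> rad n s < nn_dist x (n + 2) i"
proof -
  have "real d * ln (rad n s) = s - euler_mascheroni - ln (real (n + 1)) - ln V"
    using V_pos d_pos unfolding rad_def by (simp add: ln_powr ln_div ln_mult)
  then have "log_vol x (n + 2) i - s = real d * (ln (nn_dist x (n + 2) i) - ln (rad n s))"
    unfolding log_vol_def by (simp add: algebra_simps)
  then have "s < log_vol x (n + 2) i \<longleftrightarrow> 0 < real d * (ln (nn_dist x (n + 2) i) - ln (rad n s))"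
    by linarith
  also have "\<dots> \<longleftrightarrow> rad n s < nn_dist x (n + 2) i"
    using d_pos assms rad_pos[of n s] by (simp add: zero_less_mult_iff)
  finally show ?thesis .
qed

text \<open>The logarithm of a geometric mean is the mean of the logarithms. With a zero distance
  the left logarithm becomes 0 while the sum keeps its other terms, so for the random sample this is
  an almost sure identity.\<close>

lemma estimate_eq_mean_log_vol:
  assumes N: "N \<ge> 2" and p: "\<And>i. i \<in> {1..N} \<Longrightarrow> nn_dist x N i > 0"
  shows "real d * ln (mean_nn_dist x N) + ln V + euler_mascheroni + ln (real N - 1)
    = (\<Sum>i=1..N. log_vol x N i) / real N"
proof -
  have pr: "(\<Prod>i=1..N. nn_dist x N i) > 0" by (rule prod_pos) (use p in auto)
  have p': "nn_dist x N i \<noteq> 0" if "i \<in> {1..N}" for i using p[OF that] by simp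
  have "ln (\<Prod>i=1..N. nn_dist x N i) = (\<Sum>i=1..N. ln (nn_dist x N i))"
    by (rule ln_prod) (simp_all only: finite_atLeastAtMost p' not_False_eq_True)
  then have "ln (mean_nn_dist x N) = (\<Sum>i=1..N. ln (nn_dist x N i)) / real N"
    unfolding mean_nn_dist_def using N pr by (subst ln_root) auto
  then show ?thesis
    using N unfolding log_vol_def
    by (simp add: sum.distrib sum_distrib_left[symmetric] add_divide_distrib)
qed

end

locale iid_sample = gaussian_bounds f c C b B V d + M: prob_space M
  for f :: "'b::euclidean_space \<Rightarrow> real" and c C b B V d and M :: "'a measure" +
  fixes X :: "nat \<Rightarrow> 'a \<Rightarrow> 'b"
  assumes indep: "M.indep_vars (\<lambda>_. borel) X {1..}"
    and distr_X: "\<And>k. k \<ge> 1 \<Longrightarrow> distr M borel (X k) = \<mu>"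
begin

abbreviation nnd :: "nat \<Rightarrow> nat \<Rightarrow> 'a \<Rightarrow> real" where "nnd N i \<omega> \<equiv> nn_dist (\<lambda>k. X k \<omega>) N i"
abbreviation lv :: "nat \<Rightarrow> nat \<Rightarrow> 'a \<Rightarrow> real" where "lv N i \<omega> \<equiv> log_vol (\<lambda>k. X k \<omega>) N i"

lemma X_measurable: "k \<ge> 1 \<Longrightarrow> X k \<in> borel_measurable M"
  using indep by (auto simp: M.indep_vars_def)

lemma nnd_measurable: "i \<in> {1..N} \<Longrightarrow> nnd N i \<in> borel_measurable M"
  by (rule measurable_nn_dist[OF X_measurable])

lemma lv_measurable: "i \<in> {1..N} \<Longrightarrow> lv N i \<in> borel_measurable M"
  unfolding log_vol_def using nnd_measurable[of i N] by measurable

lemma prob_nnd_pair: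
  assumes "i \<in> {1..n + 2}" "j \<in> {1..n + 2}" "i \<noteq> j"
  shows "M.prob {\<omega>\<in>space M. r < nnd (n + 2) i \<omega> \<and> t < nnd (n + 2) j \<omega>} = avoid2 \<mu> n r t"
  using M.prob_nn_dist_pair[OF indep distr_X, of "n + 2" i j r t] assms by simp

lemma prob_nnd:
  assumes i: "i \<in> {1..n + 2}"
  shows "M.prob {\<omega>\<in>space M. r < nnd (n + 2) i \<omega>} = avoid2 \<mu> n r (-1)"
proof -
  \<comment> \<open>Any second index will do: its distance is nonnegative, so the constraint with
    radius -1 is vacuous.\<close>
  define j where "j = (if i = 1 then 2 else 1 :: nat)"
  have j: "j \<in> {1..n + 2}" "i \<noteq> j" by (auto simp: j_def)
  have "-1 < nnd (n + 2) j \<omega>" for \<omega>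
    by (subst less_nn_dist_iff[OF j(1)]) (auto intro: less_le_trans[of "-1" 0])
  then show ?thesis using prob_nnd_pair[OF i j, of r "-1"] by simp
qed

text \<open>The union bound \<open>avoid2_lower_tail\<close> at radius 0, where \<open>0 ^ d\<close>
  vanishes because the dimension is positive.\<close>

lemma AE_nnd_pos:
  assumes i: "i \<in> {1..n + 2}" shows "AE \<omega> in M. nnd (n + 2) i \<omega> > 0"
proof -
  note [measurable] = nnd_measurable[OF i]
  have "1 - avoid2 \<mu> n 0 (-1) \<le> 0"
    using avoid2_lower_tail[of 0 n] d_pos by (simp add: zero_power)
  then have "M.prob {\<omega>\<in>space M. 0 < nnd (n + 2) i \<omega>} = 1"
    using prob_nnd[OF i, of 0] M.prob_le_1[of "{\<omega>\<in>space M. 0 < nnd (n + 2) i \<omega>}"] by linarith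
  moreover have "{\<omega>\<in>space M. 0 < nnd (n + 2) i \<omega>} \<in> M.events" by measurable
  ultimately show ?thesis by (simp only: M.prob_Collect_eq_1)
qed

lemma prob_lv_pair:
  assumes i: "i \<in> {1..n + 2}" and j: "j \<in> {1..n + 2}" and ij: "i \<noteq> j"
  shows "M.prob {\<omega>\<in>space M. s < lv (n + 2) i \<omega> \<and> t < lv (n + 2) j \<omega>} = avoid2 \<mu> n (rad n s) (rad n t)"
proof -
  note [measurable] = nnd_measurable[OF i] nnd_measurable[OF j] lv_measurable[OF i] lv_measurable[OF j]
  have "M.prob {\<omega>\<in>space M. s < lv (n + 2) i \<omega> \<and> t < lv (n + 2) j \<omega>}
      = M.prob {\<omega>\<in>space M. rad n s < nnd (n + 2) i \<omega> \<and> rad n t < nnd (n + 2) j \<omega>}"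
  proof (rule M.finite_measure_eq_AE)
    show "AE \<omega> in M. (\<omega> \<in> {\<omega>\<in>space M. s < lv (n + 2) i \<omega> \<and> t < lv (n + 2) j \<omega>}) =
       (\<omega> \<in> {\<omega>\<in>space M. rad n s < nnd (n + 2) i \<omega> \<and> rad n t < nnd (n + 2) j \<omega>})"
      using AE_nnd_pos[OF i] AE_nnd_pos[OF j]
      by eventually_elim (simp only: mem_Collect_eq less_log_vol_iff)
  qed measurable
  then show ?thesis using prob_nnd_pair[OF i j ij] by simp
qed

lemma prob_lv:
  assumes i: "i \<in> {1..n + 2}"
  shows "M.prob {\<omega>\<in>space M. s < lv (n + 2) i \<omega>} = avoid2 \<mu> n (rad n s) (-1)"
proof -
  note [measurable] = nnd_measurable[OF i] lv_measurable[OF i]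
  have "M.prob {\<omega>\<in>space M. s < lv (n + 2) i \<omega>} = M.prob {\<omega>\<in>space M. rad n s < nnd (n + 2) i \<omega>}"
  proof (rule M.finite_measure_eq_AE)
    show "AE \<omega> in M. (\<omega> \<in> {\<omega>\<in>space M. s < lv (n + 2) i \<omega>}) = (\<omega> \<in> {\<omega>\<in>space M. rad n s < nnd (n + 2) i \<omega>})"
      using AE_nnd_pos[OF i] by eventually_elim (simp only: mem_Collect_eq less_log_vol_iff)
  qed measurable
  then show ?thesis using prob_nnd[OF i] by simp
qed

lemma tail_bounded_lv:
  assumes up: "\<And>n s. s \<ge> 0 \<Longrightarrow> avoid2 \<mu> n (rad n s) (-1) \<le> (q s)\<^sup>2"
    and lo: "\<And>n s. s < 0 \<Longrightarrow> 1 - avoid2 \<mu> n (rad n s) (-1) \<le> (q s)\<^sup>2"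
    and i: "i \<in> {1..n + 2}"
  shows "M.tail_bounded q (lv (n + 2) i)"
proof (rule M.tail_boundedI)
  note [measurable] = lv_measurable[OF i]
  show "lv (n + 2) i \<in> borel_measurable M" by measurable
  show "M.prob {\<omega>\<in>space M. s < lv (n + 2) i \<omega>} \<le> (q s)\<^sup>2" if "s \<ge> 0" for s
    using prob_lv[OF i] up[OF that, of n] by simp
  show "M.prob {\<omega>\<in>space M. lv (n + 2) i \<omega> \<le> s} \<le> (q s)\<^sup>2" if "s < 0" for s
  proof -
    have "M.prob {\<omega>\<in>space M. \<not> s < lv (n + 2) i \<omega>} = 1 - M.prob {\<omega>\<in>space M. s < lv (n + 2) i \<omega>}"
      by (rule M.prob_neg) measurable
    then show ?thesis using prob_lv[OF i] lo[OF that, of n] by (simp add: not_less)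
  qed
qed

definition mean_lv :: "nat \<Rightarrow> 'a \<Rightarrow> real" where
  "mean_lv n \<omega> = (\<Sum>i=1..n + 2. lv (n + 2) i \<omega>) / real (n + 2)"

lemma mean_log_vol_consistent:
  defines "H \<equiv> - (\<integral>x. ln (f x) \<partial>\<mu>)"
  shows "integrable M (mean_lv n)" (is ?i1) and "integrable M (\<lambda>\<omega>. (mean_lv n \<omega> - H)\<^sup>2)" (is ?i2)
    and "(\<lambda>n. M.expectation (mean_lv n)) \<longlonglongrightarrow> H" (is ?l1)
    and "(\<lambda>n. M.expectation (\<lambda>\<omega>. (mean_lv n \<omega> - H)\<^sup>2)) \<longlonglongrightarrow> 0" (is ?l2)
proof -
  obtain q where q: "\<And>s. 0 \<le> q s" "integrable lborel q"
    and tails: "\<And>n s. s \<ge> 0 \<Longrightarrow> avoid2 \<mu> n (rad n s) (-1) \<le> (q s)\<^sup>2"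
      "\<And>n s. s < 0 \<Longrightarrow> 1 - avoid2 \<mu> n (rad n s) (-1) \<le> (q s)\<^sup>2"
    using avoid2_tails by blast
  have tb: "M.tail_bounded q (lv (n + 2) i)" if "i \<in> {1..n + 2}" for n i
    by (rule tail_bounded_lv[OF _ _ that]) (fact tails)+
  have one: "1 \<in> {1..n + 2}" "2 \<in> {1..n + 2}" for n :: nat by auto
  define e1 where "e1 = (\<lambda>n. M.expectation (lv (n + 2) 1))"
  define e2 where "e2 = (\<lambda>n. M.expectation (\<lambda>\<omega>. lv (n + 2) 1 \<omega> * lv (n + 2) 2 \<omega>))"
  define Q where "Q = (\<integral>s. q s \<partial>lborel)\<^sup>2"
  have lim1: "e1 \<longlonglongrightarrow> H"
    unfolding e1_def H_def integral_survival[symmetric]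
    by (rule M.expectation_tendsto_of_tail(1)[OF tb[OF one(1)] q])
       (simp_all only: prob_lv[OF one(1)] avoid2_single_tendsto survival_measurable)
  have lim2: "e2 \<longlonglongrightarrow> H\<^sup>2"
    unfolding e2_def H_def integral_survival[symmetric]
  proof (rule M.expectation_mult_tendsto_of_tail[OF tb[OF one(1)] tb[OF one(2)] q])
    show "(\<lambda>n. M.prob {\<omega> \<in> space M. s < lv (n + 2) 1 \<omega> \<and> t < lv (n + 2) 2 \<omega>}) \<longlonglongrightarrow> survival s * survival t" for s t
      by (subst prob_lv_pair[OF one]) (auto intro: avoid2_pair_tendsto)
  qed (simp_all only: prob_lv[OF one(1)] prob_lv[OF one(2)] avoid2_single_tendsto survival_measurable)
  have int1: "integrable M (lv (n + 2) i)" if "i \<in> {1..n + 2}" for n i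
    by (rule M.tail_bounded_integrable[OF tb[OF that] q])
  have int2: "integrable M (\<lambda>\<omega>. lv (n + 2) i \<omega> * lv (n + 2) j \<omega>)" if "i \<in> {1..n + 2}" "j \<in> {1..n + 2}" for n i j
    by (rule M.tail_bounded_mult(1)[OF tb[OF that(1)] tb[OF that(2)] q])
  \<comment> \<open>Exchangeability enters only through the formulas: the tail probability is the
    same \<open>avoid2\<close> value for every index, so the layer cake integrals agree.
    \<open>E2\<close> repeats this for pairs.\<close>
  have E1: "M.expectation (lv (n + 2) i) = e1 n" if "i \<in> {1..n + 2}" for n i
    using M.expectation_eq_integral_tail[OF int1[OF that]] M.expectation_eq_integral_tail[OF int1[OF one(1), of n]]
    unfolding e1_def prob_lv[OF that] prob_lv[OF one(1)] by (rule has_bochner_integral_eq)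
  have E2: "M.expectation (\<lambda>\<omega>. lv (n + 2) i \<omega> * lv (n + 2) j \<omega>) = e2 n"
    if ij: "i \<in> {1..n + 2}" "j \<in> {1..n + 2}" "i \<noteq> j" for n i j
  proof -
    have "M.expectation (\<lambda>\<omega>. tail_kernel (lv (n + 2) i \<omega>) s * tail_kernel (lv (n + 2) j \<omega>) t)
        = M.expectation (\<lambda>\<omega>. tail_kernel (lv (n + 2) 1 \<omega>) s * tail_kernel (lv (n + 2) 2 \<omega>) t)" for s t
      unfolding M.expectation_tail_kernel_mult[OF lv_measurable[OF ij(1)] lv_measurable[OF ij(2)]]
        M.expectation_tail_kernel_mult[OF lv_measurable[OF one(1)] lv_measurable[OF one(2)]]
        prob_lv_pair[OF ij] prob_lv[OF ij(1)] prob_lv[OF ij(2)]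
        prob_lv[OF one(1)] prob_lv[OF one(2)]
      by (subst prob_lv_pair[OF one]) auto
    then show ?thesis
      unfolding e2_def M.tail_bounded_mult(3)[OF tb[OF ij(1)] tb[OF ij(2)] q]
        M.tail_bounded_mult(3)[OF tb[OF one(1)] tb[OF one(2)] q] by simp
  qed
  have E3: "M.expectation (\<lambda>\<omega>. lv (n + 2) i \<omega> * lv (n + 2) i \<omega>) \<le> Q" if "i \<in> {1..n + 2}" for n i
    using M.tail_bounded_mult(2)[OF tb[OF that] tb[OF that] q] by (simp add: Q_def)
  have A1: "integrable M (mean_lv n)" "M.expectation (mean_lv n) = e1 n" for n
  proof -
    show "integrable M (mean_lv n)"
      unfolding mean_lv_def[abs_def] by (intro integrable_divide Bochner_Integration.integrable_sum int1)
    have "M.expectation (mean_lv n) = (\<Sum>i=1..n + 2. M.expectation (lv (n + 2) i)) / real (n + 2)"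
      unfolding mean_lv_def[abs_def] Bochner_Integration.integral_divide_zero
      by (subst Bochner_Integration.integral_sum[OF int1]) (assumption, rule refl)
    also have "(\<Sum>i=1..n + 2. M.expectation (lv (n + 2) i)) = (\<Sum>i=1..n + 2. e1 n)"
      by (rule sum.cong[OF refl E1])
    finally show "M.expectation (mean_lv n) = e1 n" by simp
  qed
  have sq: "(\<lambda>\<omega>. (mean_lv n \<omega>)\<^sup>2) = (\<lambda>\<omega>. (\<Sum>i=1..n + 2. \<Sum>j=1..n + 2. lv (n + 2) i \<omega> * lv (n + 2) j \<omega>) / (real (n + 2))\<^sup>2)" for n
    unfolding mean_lv_def[abs_def] by (simp only: power2_eq_square times_divide_times_eq sum_product)
  have A2: "integrable M (\<lambda>\<omega>. (mean_lv n \<omega>)\<^sup>2)" for n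
    unfolding sq by (intro integrable_divide Bochner_Integration.integrable_sum int2)
  have A3: "M.expectation (\<lambda>\<omega>. (mean_lv n \<omega>)\<^sup>2) \<le> (real (n + 2) * Q + real (n + 2) * real (n + 1) * e2 n) / (real (n + 2))\<^sup>2" for n
  proof -
    have "M.expectation (\<lambda>\<omega>. \<Sum>i=1..n + 2. \<Sum>j=1..n + 2. lv (n + 2) i \<omega> * lv (n + 2) j \<omega>)
        = (\<Sum>i=1..n + 2. \<Sum>j=1..n + 2. M.expectation (\<lambda>\<omega>. lv (n + 2) i \<omega> * lv (n + 2) j \<omega>))"
      by (subst Bochner_Integration.integral_sum; intro Bochner_Integration.integrable_sum int2 sum.cong refl Bochner_Integration.integral_sum; assumption)
    also have "\<dots> \<le> (\<Sum>i=1..n + 2. Q + real (n + 1) * e2 n)"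
    proof (rule sum_mono)
      fix i assume i: "i \<in> {1..n + 2}"
      have "(\<Sum>j=1..n + 2. M.expectation (\<lambda>\<omega>. lv (n + 2) i \<omega> * lv (n + 2) j \<omega>))
         = M.expectation (\<lambda>\<omega>. lv (n + 2) i \<omega> * lv (n + 2) i \<omega>) + (\<Sum>j\<in>{1..n + 2} - {i}. M.expectation (\<lambda>\<omega>. lv (n + 2) i \<omega> * lv (n + 2) j \<omega>))"
        by (rule sum.remove) (use i in auto)
      also have "(\<Sum>j\<in>{1..n + 2} - {i}. M.expectation (\<lambda>\<omega>. lv (n + 2) i \<omega> * lv (n + 2) j \<omega>)) = (\<Sum>j\<in>{1..n + 2} - {i}. e2 n)"
        by (rule sum.cong[OF refl], rule E2) (use i in auto)
      also have "\<dots> = real (n + 1) * e2 n" using i by simp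
      finally show "(\<Sum>j=1..n + 2. M.expectation (\<lambda>\<omega>. lv (n + 2) i \<omega> * lv (n + 2) j \<omega>)) \<le> Q + real (n + 1) * e2 n"
        using E3[OF i] by linarith
    qed
    also have "\<dots> = real (n + 2) * Q + real (n + 2) * real (n + 1) * e2 n" by (simp add: algebra_simps)
    finally show ?thesis unfolding sq by (simp only: Bochner_Integration.integral_divide_zero divide_right_mono zero_le_power2)
  qed
  have ex: "(\<lambda>\<omega>. (mean_lv n \<omega> - H)\<^sup>2) = (\<lambda>\<omega>. (mean_lv n \<omega>)\<^sup>2 - 2 * H * mean_lv n \<omega> + H\<^sup>2)" for n
    by (simp add: power2_diff algebra_simps)
  show ?i1 by (rule A1)
  show ?i2 unfolding ex using A1 A2 by auto
  show ?l1 unfolding A1(2) by (rule lim1)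
  have eq: "M.expectation (\<lambda>\<omega>. (mean_lv n \<omega> - H)\<^sup>2) = M.expectation (\<lambda>\<omega>. (mean_lv n \<omega>)\<^sup>2) - 2 * H * e1 n + H\<^sup>2" for n
    unfolding ex using A1[of n] A2[of n] M.prob_space by simp
  show ?l2
  proof (rule second_moment_mean_tendsto_0[OF lim1 lim2])
    show "0 \<le> M.expectation (\<lambda>\<omega>. (mean_lv n \<omega> - H)\<^sup>2)" for n
      by (rule Bochner_Integration.integral_nonneg) simp
    show "M.expectation (\<lambda>\<omega>. (mean_lv n \<omega> - H)\<^sup>2)
      \<le> (real (n + 2) * Q + real (n + 2) * real (n + 1) * e2 n) / (real (n + 2))\<^sup>2 - 2 * H * e1 n + H\<^sup>2" for n
      unfolding eq using A3[of n] by linarith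
  qed
qed

lemma estimate_consistent:
  defines "H \<equiv> - (\<integral>x. ln (f x) \<partial>\<mu>)"
    and "A \<equiv> (\<lambda>N \<omega>. real d * ln (mean_nn_dist (\<lambda>k. X k \<omega>) N) + ln V + euler_mascheroni + ln (real N - 1))"
  shows "N \<ge> 2 \<Longrightarrow> integrable M (A N)" and "N \<ge> 2 \<Longrightarrow> integrable M (\<lambda>\<omega>. (A N \<omega> - H)\<^sup>2)"
    and "(\<lambda>N. M.expectation (A N)) \<longlonglongrightarrow> H"
    and "(\<lambda>N. M.expectation (\<lambda>\<omega>. (A N \<omega> - H)\<^sup>2)) \<longlonglongrightarrow> 0"
proof -
  note cons = mean_log_vol_consistent[folded H_def]
  have Am: "A N \<in> borel_measurable M" if "N \<ge> 2" for N
  proof -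
    have "(\<lambda>\<omega>. \<Prod>i=1..N. nnd N i \<omega>) \<in> borel_measurable M"
      by (intro borel_measurable_prod nnd_measurable)
    moreover have "root N \<in> borel_measurable borel"
      by (intro borel_measurable_continuous_onI continuous_on_real_root continuous_on_id)
    ultimately have "(\<lambda>\<omega>. mean_nn_dist (\<lambda>k. X k \<omega>) N) \<in> borel_measurable M"
      unfolding mean_nn_dist_def by (rule measurable_compose)
    then show ?thesis unfolding A_def by measurable
  qed
  have Lm: "mean_lv n \<in> borel_measurable M" for n by (rule borel_measurable_integrable[OF cons(1)])
  \<comment> \<open>The identity fails on coincident samples, so integrability and integrals are
    transferred almost everywhere, with measurability of \<open>A\<close> established on its
    own.\<close>
  have ae: "AE \<omega> in M. A (n + 2) \<omega> = mean_lv n \<omega>" for n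
  proof -
    have "AE \<omega> in M. \<forall>i\<in>{1..n + 2}. nnd (n + 2) i \<omega> > 0"
      by (rule AE_finite_allI[OF finite_atLeastAtMost AE_nnd_pos])
    then show ?thesis
      unfolding A_def mean_lv_def by eventually_elim (rule estimate_eq_mean_log_vol, auto)
  qed
  have ae2: "AE \<omega> in M. (A (n + 2) \<omega> - H)\<^sup>2 = (mean_lv n \<omega> - H)\<^sup>2" for n
    using ae[of n] by eventually_elim simp
  note Am2 = Am[of "_ + 2", OF le_add2]
  have sqm: "(\<lambda>\<omega>. (A (n + 2) \<omega> - H)\<^sup>2) \<in> borel_measurable M" "(\<lambda>\<omega>. (mean_lv n \<omega> - H)\<^sup>2) \<in> borel_measurable M" for n
    by (intro borel_measurable_power borel_measurable_diff borel_measurable_const Am2 Lm)+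
  have i: "integrable M (A (n + 2))" "integrable M (\<lambda>\<omega>. (A (n + 2) \<omega> - H)\<^sup>2)" for n
    using integrable_cong_AE[OF Am2 Lm ae, of n] integrable_cong_AE[OF sqm ae2, of n] cons(1,2)[of n] by simp_all
  have e: "M.expectation (A (n + 2)) = M.expectation (mean_lv n)"
     "M.expectation (\<lambda>\<omega>. (A (n + 2) \<omega> - H)\<^sup>2) = M.expectation (\<lambda>\<omega>. (mean_lv n \<omega> - H)\<^sup>2)" for n
    using integral_cong_AE[OF Am2 Lm ae, of n] integral_cong_AE[OF sqm ae2, of n] by simp_all
  show "integrable M (A N)" if "N \<ge> 2"
    using i(1)[of "N - 2"] that by (simp only: le_add_diff_inverse2)
  show "integrable M (\<lambda>\<omega>. (A N \<omega> - H)\<^sup>2)" if "N \<ge> 2"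
    using i(2)[of "N - 2"] that by (simp only: le_add_diff_inverse2)
  show "(\<lambda>N. M.expectation (A N)) \<longlonglongrightarrow> H"
    by (rule LIMSEQ_offset[of _ 2]) (simp only: e cons(3))
  show "(\<lambda>N. M.expectation (\<lambda>\<omega>. (A N \<omega> - H)\<^sup>2)) \<longlonglongrightarrow> 0"
    by (rule LIMSEQ_offset[of _ 2]) (simp only: e cons(4))
qed

end

section \<open>Linear change of variables\<close>

lemma Basis_real_vec: "(Basis :: (real^'d) set) = (\<lambda>i. axis i 1) ` UNIV"
  by (auto simp: Basis_vec_def)

lemma prod_Basis_real_vec: "(\<Prod>b\<in>(Basis :: (real^'d) set). g b) = (\<Prod>i\<in>UNIV. g (axis i 1))"
proof -
  have "inj (\<lambda>i::'d. axis i (1::real))" by (auto simp: inj_def axis_eq_axis)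
  then show ?thesis unfolding Basis_real_vec by (subst prod.reindex) auto
qed

lemma borel_measurable_vec_lambda:
  fixes g :: "'d::finite \<Rightarrow> 'a \<Rightarrow> real"
  assumes "\<And>i. g i \<in> borel_measurable M"
  shows "(\<lambda>x. \<chi> i. g i x) \<in> borel_measurable M"
  by (subst borel_measurable_euclidean_space) (auto simp: Basis_real_vec assms simp flip: cart_eq_inner_axis)

text \<open>Lebesgue measure is characterised by box volumes. The product form allows a single
  coordinate to be integrated out.\<close>

lemma lborel_vec_eq_PiM:
  "(lborel :: (real^'d) measure) = distr (\<Pi>\<^sub>M i\<in>UNIV. lborel) borel (\<lambda>x. \<chi> i. x i)"
proof (rule lborel_eqI)
  interpret product_sigma_finite "\<lambda>_::'d. lborel :: real measure" ..
  fix l u :: "real^'d" assume le: "\<And>b. b \<in> Basis \<Longrightarrow> l \<bullet> b \<le> u \<bullet> b"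
  then have le': "l $ i \<le> u $ i" for i by (simp add: cart_eq_inner_axis Basis_real_vec)
  have m: "(\<lambda>x. \<chi> i. x i) \<in> measurable (\<Pi>\<^sub>M i\<in>(UNIV::'d set). lborel) (borel :: (real^'d) measure)"
    by (rule borel_measurable_vec_lambda) measurable
  have v: "(\<lambda>x. \<chi> i. x i) -` box l u \<inter> space (\<Pi>\<^sub>M i\<in>(UNIV::'d set). lborel)
      = (\<Pi>\<^sub>E i\<in>UNIV. {l $ i<..<u $ i})"
    by (auto simp: mem_box_cart space_PiM PiE_iff)
  have "emeasure (distr (\<Pi>\<^sub>M i\<in>(UNIV::'d set). lborel) borel (\<lambda>x. \<chi> i. x i)) (box l u) = (\<Prod>i\<in>UNIV. ennreal (u $ i - l $ i))"
    by (subst emeasure_distr[OF m]) (simp_all add: v emeasure_PiM le')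
  also have "\<dots> = ennreal (\<Prod>i\<in>UNIV. u $ i - l $ i)" by (rule prod_ennreal) (simp add: le')
  also have "(\<Prod>i\<in>UNIV. u $ i - l $ i) = (\<Prod>b\<in>Basis. (u - l) \<bullet> b)"
  proof -
      show ?thesis by (simp add: prod_Basis_real_vec cart_eq_inner_axis inner_diff_left)
  qed
  finally show "emeasure (distr (\<Pi>\<^sub>M i\<in>(UNIV::'d set). lborel) borel (\<lambda>x. \<chi> i. x i)) (box l u) = ennreal (\<Prod>b\<in>Basis. (u - l) \<bullet> b)" .
qed simp

lemma measurable_vec_of_fun:
  "(\<lambda>x. \<chi> i. x i) \<in> measurable (\<Pi>\<^sub>M i\<in>(UNIV::'d::finite set). (lborel::real measure)) borel"
  by (rule borel_measurable_vec_lambda) measurable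

lemma matrix_vector_mult_measurable[measurable]:
  "(\<lambda>x. (A :: real^'d^'d) *v x) \<in> borel_measurable borel"
  by (intro borel_measurable_continuous_onI linear_continuous_on) (simp add: linear_linear)

text \<open>With all coordinates other than \<open>m\<close> fixed, the shear translates coordinate
  \<open>m\<close> by the constant \<open>c * x n\<close>, since n differs from m. Integrating that
  coordinate first reduces the claim to translation invariance on the line.\<close>

lemma nn_integral_shear:
  fixes h :: "real^'d \<Rightarrow> ennreal"
  assumes [measurable]: "h \<in> borel_measurable borel" and mn: "m \<noteq> n"
  shows "(\<integral>\<^sup>+x. h (\<chi> i. if i = m then x $ m + c * x $ n else x $ i) \<partial>lborel) = (\<integral>\<^sup>+x. h x \<partial>lborel)"
proof -
  let ?I = "UNIV - {m}"
  let ?U = "insert m ?I"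
  let ?P = "\<lambda>I. \<Pi>\<^sub>M i\<in>I. (lborel :: real measure)"
  interpret product_sigma_finite "\<lambda>_::'d. lborel :: real measure" ..
  have U: "?U = UNIV" by auto
  define H where "H = (\<lambda>x. h (\<chi> i. x i))"
  define S where "S = (\<lambda>x. (\<chi> i. if i = m then x $ m + c * x $ n else x $ i) :: real^'d)"
  have Sm[measurable]: "S \<in> borel_measurable borel"
    unfolding S_def by (rule borel_measurable_vec_lambda) measurable
  have Hm[measurable]: "H \<in> borel_measurable (?P ?U)"
    unfolding H_def U by (rule measurable_compose[OF measurable_vec_of_fun]) simp
  have HS: "(\<lambda>x. h (S (\<chi> i. x i))) \<in> borel_measurable (?P ?U)"
    unfolding U by (rule measurable_compose[OF measurable_vec_of_fun]) measurable
  have "(\<integral>\<^sup>+x. h (S x) \<partial>lborel) = (\<integral>\<^sup>+x. h (S (\<chi> i. x i)) \<partial>?P ?U)"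
    unfolding lborel_vec_eq_PiM U by (subst nn_integral_distr[OF measurable_vec_of_fun]) auto
  also have "\<dots> = (\<integral>\<^sup>+x. \<integral>\<^sup>+y. h (S (\<chi> i. (x(m := y)) i)) \<partial>lborel \<partial>?P ?I)"
    by (rule product_nn_integral_insert[OF _ _ HS]) auto
  also have "\<dots> = (\<integral>\<^sup>+x. \<integral>\<^sup>+y. H (x(m := c * x n + 1 * y)) \<partial>lborel \<partial>?P ?I)"
    using mn by (intro nn_integral_cong) (auto simp: H_def S_def vec_eq_iff intro!: arg_cong[where f=h])
  also have "\<dots> = (\<integral>\<^sup>+x. \<integral>\<^sup>+y. H (x(m := y)) \<partial>lborel \<partial>?P ?I)"
  proof (rule nn_integral_cong)
    fix x assume x: "x \<in> space (?P ?I)"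
    have "(\<lambda>y. H (x(m := y))) \<in> borel_measurable borel"
      using x by (intro measurable_compose[OF _ Hm] measurable_fun_upd[where J="?I"]) auto
    from nn_integral_real_affine[OF this, of 1 "c * x n"]
    show "(\<integral>\<^sup>+y. H (x(m := c * x n + 1 * y)) \<partial>lborel) = (\<integral>\<^sup>+y. H (x(m := y)) \<partial>lborel)" by simp
  qed
  also have "\<dots> = (\<integral>\<^sup>+x. H x \<partial>?P ?U)"
    by (rule product_nn_integral_insert[OF _ _ Hm, symmetric]) auto
  also have "\<dots> = (\<integral>\<^sup>+x. h x \<partial>lborel)"
    unfolding lborel_vec_eq_PiM U H_def by (subst nn_integral_distr[OF measurable_vec_of_fun]) auto
  finally show ?thesis by (simp add: S_def)
qed

text \<open>The preimage of a box is the box with permuted sides, and the product of the side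
  lengths does not change.\<close>

lemma nn_integral_permute_coords:
  fixes h :: "real^'d \<Rightarrow> ennreal"
  assumes [measurable]: "h \<in> borel_measurable borel" and p: "p permutes (UNIV :: 'd set)"
  shows "(\<integral>\<^sup>+x. h (\<chi> i. x $ p i) \<partial>lborel) = (\<integral>\<^sup>+x. h x \<partial>lborel)"
proof -
  let ?S = "\<lambda>x::real^'d. \<chi> i. x $ p i"
  have Sm: "?S \<in> borel_measurable borel" by (rule borel_measurable_vec_lambda) measurable
  have pi: "p (inv p i) = i" "inv p (p i) = i" for i using permutes_inverses[OF p] by auto
  have "(lborel :: (real^'d) measure) = distr lborel borel ?S"
  proof (rule lborel_eqI)
    fix l u :: "real^'d" assume le: "\<And>b. b \<in> Basis \<Longrightarrow> l \<bullet> b \<le> u \<bullet> b"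
    then have le': "l $ i \<le> u $ i" for i by (simp add: cart_eq_inner_axis Basis_real_vec)
    define l' u' where "l' = (\<chi> i. l $ inv p i)" and "u' = (\<chi> i. u $ inv p i)"
      have P: "(\<Prod>b\<in>Basis. v \<bullet> b) = (\<Prod>i\<in>UNIV. v $ i)" for v :: "real^'d"
      by (simp add: prod_Basis_real_vec cart_eq_inner_axis)
    have vim: "?S -` box l u = box l' u'"
    proof (intro set_eqI)
      fix x :: "real^'d"
      have "(\<forall>i. l $ i < x $ p i \<and> x $ p i < u $ i) \<longleftrightarrow> (\<forall>j. l $ inv p j < x $ j \<and> x $ j < u $ inv p j)"
        by (metis pi)
      then show "x \<in> ?S -` box l u \<longleftrightarrow> x \<in> box l' u'" by (simp add: mem_box_cart l'_def u'_def)
    qed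
    have "emeasure (distr lborel borel ?S) (box l u) = emeasure lborel (box l' u')"
      using Sm by (subst emeasure_distr) (auto simp: vim)
    also have "\<dots> = ennreal (\<Prod>b\<in>Basis. (u' - l') \<bullet> b)"
      by (rule emeasure_lborel_box) (auto simp: Basis_real_vec l'_def u'_def le' simp flip: cart_eq_inner_axis)
    also have "(\<Prod>b\<in>Basis. (u' - l') \<bullet> b) = (\<Prod>i\<in>UNIV. (u - l) $ inv p i)"
      unfolding P by (simp add: l'_def u'_def)
    also have "\<dots> = (\<Prod>b\<in>Basis. (u - l) \<bullet> b)"
      unfolding P by (rule prod.permute[OF permutes_inv[OF p], symmetric, unfolded comp_def])
    finally show "emeasure (distr lborel borel ?S) (box l u) = ennreal (\<Prod>b\<in>Basis. (u - l) \<bullet> b)" .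
  qed simp
  then have "(\<integral>\<^sup>+x. h x \<partial>lborel) = (\<integral>\<^sup>+x. h x \<partial>distr lborel borel ?S)" by simp
  also have "\<dots> = (\<integral>\<^sup>+x. h (?S x) \<partial>lborel)" using Sm by (subst nn_integral_distr) auto
  finally show ?thesis ..
qed

lemma nn_integral_diagonal:
  fixes h :: "real^'d \<Rightarrow> ennreal"
  assumes [measurable]: "h \<in> borel_measurable borel"
    and diag: "\<And>i j. i \<noteq> j \<Longrightarrow> A $ i $ j = 0" and det: "det (A :: real^'d^'d) \<noteq> 0"
  shows "(\<integral>\<^sup>+x. h x \<partial>lborel) = ennreal \<bar>det A\<bar> * (\<integral>\<^sup>+x. h (A *v x) \<partial>lborel)"
proof -
  define a where "a = (\<lambda>b. (A *v b) \<bullet> b)"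
  have a: "a (axis i 1) = A $ i $ i" for i
    by (simp add: a_def matrix_vector_mult_basis column_def flip: cart_eq_inner_axis)
  have det_eq: "det A = (\<Prod>i\<in>UNIV. A $ i $ i)" by (rule det_diagonal) (rule diag)
  then have nz: "a b \<noteq> 0" if "b \<in> Basis" for b using det that by (auto simp: Basis_real_vec a)
  have T: "0 + (\<Sum>j\<in>Basis. (a j * (x \<bullet> j)) *\<^sub>R j) = A *v x" for x
  proof (rule euclidean_eqI)
    fix b :: "real^'d" assume b: "b \<in> Basis"
    then obtain i where i: "b = axis i 1" by (auto simp: Basis_real_vec)
    have "(A *v x) $ i = (\<Sum>j\<in>UNIV. if j = i then A $ i $ i * x $ i else 0)"
      unfolding matrix_vector_mult_def vec_lambda_beta
      by (rule sum.cong) (use diag[of i] in auto)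
    moreover have "(0 + (\<Sum>j\<in>Basis. (a j * (x \<bullet> j)) *\<^sub>R j)) \<bullet> b = a b * (x \<bullet> b)"
      by (subst add_0_left, rule inner_sum_left_Basis[OF b])
    ultimately show "(0 + (\<Sum>j\<in>Basis. (a j * (x \<bullet> j)) *\<^sub>R j)) \<bullet> b = (A *v x) \<bullet> b"
      unfolding i a by (simp only: cart_eq_inner_axis[symmetric] sum.delta finite_UNIV) simp
  qed
  have "(\<Prod>j\<in>Basis. \<bar>a j\<bar>) = \<bar>det A\<bar>"
    unfolding det_eq prod_Basis_real_vec by (simp add: a abs_prod)
  then have L: "lborel = density (distr lborel borel (\<lambda>x. A *v x)) (\<lambda>_. ennreal \<bar>det A\<bar>)"
    using lborel_affine_euclidean[of a "0 :: real^'d", OF nz] unfolding T by simp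
  have "(\<integral>\<^sup>+x. h x \<partial>lborel) = (\<integral>\<^sup>+x. h x \<partial>density (distr lborel borel (\<lambda>x. A *v x)) (\<lambda>_. ennreal \<bar>det A\<bar>))"
    using L by simp
  also have "\<dots> = ennreal \<bar>det A\<bar> * (\<integral>\<^sup>+x. h (A *v x) \<partial>lborel)"
    by (simp add: nn_integral_density nn_integral_distr nn_integral_cmult)
  finally show ?thesis .
qed

text \<open>Change of variables is stable under matrix products because the determinant is
  multiplicative, so elementary matrices suffice: diagonal ones scale, while swaps and shears have
  determinant of modulus 1 and preserve Lebesgue measure.\<close>

lemma nn_integral_matrix:
  fixes h :: "real^'d \<Rightarrow> ennreal" and A :: "real^'d^'d"
  assumes "h \<in> borel_measurable borel" and "det A \<noteq> 0"
  shows "(\<integral>\<^sup>+x. h x \<partial>lborel) = ennreal \<bar>det A\<bar> * (\<integral>\<^sup>+x. h (A *v x) \<partial>lborel)"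
proof -
  \<comment> \<open>The implication makes singular matrices, which the induction also visits,
    trivially good. The quantifier over \<open>h\<close> lets the product step apply the hypothesis
    for the inner matrix to h composed with the outer one.\<close>
  define P where "P = (\<lambda>A::real^'d^'d. det A \<noteq> 0 \<longrightarrow> (\<forall>h::real^'d \<Rightarrow> ennreal. h \<in> borel_measurable borel \<longrightarrow>
    (\<integral>\<^sup>+x. h x \<partial>lborel) = ennreal \<bar>det A\<bar> * (\<integral>\<^sup>+x. h (A *v x) \<partial>lborel)))"
  have PD: "(\<integral>\<^sup>+x. h x \<partial>lborel) = ennreal \<bar>det A\<bar> * (\<integral>\<^sup>+x. h (A *v x) \<partial>lborel)"
    if "P A" "det A \<noteq> 0" "h \<in> borel_measurable borel" for A and h :: "real^'d \<Rightarrow> ennreal"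
    using that unfolding P_def by blast
  have "P A"
  proof (rule induct_matrix_elementary[of P])
    fix A B assume AB: "P A" "P B"
    show "P (A ** B)"
      unfolding P_def
    proof (intro impI allI)
      fix h :: "real^'d \<Rightarrow> ennreal"
      assume det: "det (A ** B) \<noteq> 0" and [measurable]: "h \<in> borel_measurable borel"
      have "(\<integral>\<^sup>+x. h x \<partial>lborel) = ennreal \<bar>det A\<bar> * (\<integral>\<^sup>+x. h (A *v x) \<partial>lborel)"
        using det by (intro PD[OF AB(1)]) (auto simp: det_mul)
      also have "(\<integral>\<^sup>+x. h (A *v x) \<partial>lborel) = ennreal \<bar>det B\<bar> * (\<integral>\<^sup>+x. h (A *v (B *v x)) \<partial>lborel)"
        using det by (intro PD[OF AB(2)]) (auto simp: det_mul)
      finally show "(\<integral>\<^sup>+x. h x \<partial>lborel) = ennreal \<bar>det (A ** B)\<bar> * (\<integral>\<^sup>+x. h ((A ** B) *v x) \<partial>lborel)"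
        by (simp add: det_mul abs_mult ennreal_mult mult.assoc matrix_vector_mul_assoc)
    qed
  next
    fix A :: "real^'d^'d" and i assume "row i A = 0"
    then show "P A" by (simp add: P_def det_zero_row)
  next
    fix A :: "real^'d^'d" assume "\<And>i j. i \<noteq> j \<Longrightarrow> A $ i $ j = 0"
    then show "P A" unfolding P_def using nn_integral_diagonal[of _ A] by blast
  next
    fix m n :: 'd assume mn: "m \<noteq> n"
    let ?t = "Transposition.transpose m n"
    let ?A = "(\<chi> i j. mat 1 $ i $ ?t j) :: real^'d^'d"
    have t: "?t permutes UNIV" by (rule permutes_swap_id) auto
    have "det ?A = of_int (sign ?t) * det (mat 1 :: real^'d^'d)" by (rule det_permute_columns[OF t])
    then have d: "\<bar>det ?A\<bar> = 1" by (simp add: sign_def)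
    have v: "?A *v x = (\<chi> i. x $ ?t i)" for x
    proof -
      have "(?A *v x) $ i = (\<Sum>j\<in>UNIV. if j = ?t i then x $ ?t i else 0)" for i
      proof -
        have "(i = ?t j) = (j = ?t i)" for j by (metis transpose_involutory)
        then show ?thesis
          unfolding matrix_vector_mult_def mat_def vec_lambda_beta by (intro sum.cong) auto
      qed
      then show ?thesis by (simp add: vec_eq_iff)
    qed
    show "P ?A" unfolding P_def d v using nn_integral_permute_coords[OF _ t] by simp
  next
    fix m n :: 'd and c assume mn: "m \<noteq> n"
    let ?A = "(\<chi> i j. if i = m \<and> j = n then c else of_bool (i = j)) :: real^'d^'d"
    have "?A = (\<chi> k. if k = m then row m (mat 1) + c *s row n (mat 1) else row k (mat 1))"
      using mn by (auto simp: vec_eq_iff row_def mat_def)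
    then have d: "det ?A = 1" using det_row_operation[OF mn, of "mat 1 :: real^'d^'d" c] by simp
    have v: "?A *v x = (\<chi> i. if i = m then x $ m + c * x $ n else x $ i)" for x
    proof -
      have "(?A *v x) $ i = (if i = m then x $ m + c * x $ n else x $ i)" for i
      proof -
        have "(?A *v x) $ i = (\<Sum>j\<in>UNIV. (if j = i then x $ i else 0) + (if j = n then (if i = m then c * x $ n else 0) else 0))"
          unfolding matrix_vector_mult_def using mn by (auto intro!: sum.cong)
        then show ?thesis by (simp add: sum.distrib)
      qed
      then show ?thesis by (simp add: vec_eq_iff)
    qed
    show "P ?A" unfolding P_def d v using nn_integral_shear[OF _ mn] by simp
  qed
  from PD[OF this assms(2,1)] show ?thesis .
qed

section \<open>Gaussian vectors\<close>

lemma lborel_vec_prod: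
  fixes h :: "'d::finite \<Rightarrow> real \<Rightarrow> real"
  assumes h: "\<And>i. integrable lborel (h i)"
  shows "integrable lborel (\<lambda>z::real^'d. \<Prod>i\<in>UNIV. h i (z $ i))" (is ?A)
    and "(\<integral>z. (\<Prod>i\<in>UNIV. h i ((z :: real^'d) $ i)) \<partial>lborel) = (\<Prod>i\<in>UNIV. (\<integral>t. h i t \<partial>lborel))" (is ?B)
proof -
  let ?P = "\<Pi>\<^sub>M i\<in>(UNIV :: 'd set). (lborel :: real measure)"
  have [measurable]: "h i \<in> borel_measurable borel" for i using h[of i] by auto
  interpret product_sigma_finite "\<lambda>_::'d. lborel :: real measure" ..
  have m: "(\<lambda>z::real^'d. \<Prod>i\<in>UNIV. h i (z $ i)) \<in> borel_measurable borel" by measurable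
  show ?A
    unfolding lborel_vec_eq_PiM using product_integrable_prod[of UNIV h] h
    by (subst integrable_distr_eq[OF measurable_vec_of_fun m]) simp
  show ?B
    unfolding lborel_vec_eq_PiM using product_integral_prod[of UNIV h] h
    by (subst integral_distr[OF measurable_vec_of_fun m]) simp
qed

section \<open>Moments of the standard normal vector\<close>

definition std_vec_density :: "real ^ 'd \<Rightarrow> real" where
  "std_vec_density z = (\<Prod>i\<in>UNIV. std_normal_density (z $ i))"

lemma std_normal_vec_eq: "std_normal_vec = density lborel (\<lambda>z. ennreal (std_vec_density z))"
  by (simp add: std_normal_vec_def std_vec_density_def)

lemma std_vec_density_nonneg: "0 \<le> std_vec_density z"
  unfolding std_vec_density_def by (intro prod_nonneg) auto

lemma std_vec_density_measurable[measurable]: "std_vec_density \<in> borel_measurable borel"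
  unfolding std_vec_density_def[abs_def] by measurable

lemma std_vec_density_eq:
  "std_vec_density (z :: real^'d) = (1 / sqrt (2 * pi)) ^ CARD('d) * exp (- (norm z)\<^sup>2 / 2)"
proof -
  have "(norm z)\<^sup>2 = (\<Sum>i\<in>UNIV. (z $ i)\<^sup>2)"
    by (simp add: norm_vec_def L2_set_def sum_nonneg)
  then have "exp (- (norm z)\<^sup>2 / 2) = (\<Prod>i\<in>UNIV. exp (- (z $ i)\<^sup>2 / 2))"
    by (simp add: exp_sum[symmetric] sum_negf sum_divide_distrib[symmetric])
  then show ?thesis
    unfolding std_vec_density_def std_normal_density_def prod.distrib by simp
qed

lemma std_normal_moments:
  "has_bochner_integral lborel std_normal_density 1"
  "has_bochner_integral lborel (\<lambda>t. std_normal_density t * t) 0"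
  "has_bochner_integral lborel (\<lambda>t. std_normal_density t * t\<^sup>2) 1"
  using std_normal_moment_even[of 0] std_normal_moment_odd[of 0] std_normal_moment_even[of 1]
  by simp_all

lemma std_normal_vec_integralI:
  fixes g :: "real^'d \<Rightarrow> real"
  assumes "g \<in> borel_measurable borel"
    and "has_bochner_integral lborel (\<lambda>z. std_vec_density z * g z) v"
  shows "has_bochner_integral std_normal_vec g v"
  using assms unfolding std_normal_vec_eq
  by (intro has_bochner_integral_density) (auto simp: std_vec_density_nonneg)

text \<open>One formula for all moments below: the exponent vector 0 gives the total mass, a unit
  vector the mean, and a sum of two unit vectors the covariance. A single exponent 1 annihilates the
  product.\<close>

lemma std_normal_vec_prod_moment:
  fixes e :: "'d::finite \<Rightarrow> nat"
  assumes "\<And>i. e i \<le> 2"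
  shows "has_bochner_integral std_normal_vec (\<lambda>z. \<Prod>i\<in>UNIV. (z $ i) ^ e i) (\<Prod>i\<in>UNIV. if e i = 1 then 0 else 1)"
proof -
  have hb: "has_bochner_integral lborel (\<lambda>t. std_normal_density t * t ^ e i) (if e i = 1 then 0 else 1)" for i
  proof -
    consider "e i = 0" | "e i = 1" | "e i = 2" using assms[of i] by linarith
    then show ?thesis by cases (use std_normal_moments in auto)
  qed
  have "has_bochner_integral lborel (\<lambda>z::real^'d. \<Prod>i\<in>UNIV. std_normal_density (z $ i) * (z $ i) ^ e i) (\<Prod>i\<in>UNIV. if e i = 1 then 0 else 1)"
    using lborel_vec_prod[of "\<lambda>i t. std_normal_density t * t ^ e i"] hb
    by (auto simp: has_bochner_integral_iff)
  then show ?thesis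
    by (intro std_normal_vec_integralI) (auto simp: std_vec_density_def prod.distrib)
qed

lemma std_normal_vec_const: "has_bochner_integral std_normal_vec (\<lambda>z::real^'d. 1) (1::real)"
  using std_normal_vec_prod_moment[of "\<lambda>_::'d. 0"] by simp

lemma emeasure_std_normal_vec: "emeasure std_normal_vec (UNIV :: (real^'d) set) = 1"
proof -
  have "ennreal 1 = (\<integral>\<^sup>+z. ennreal 1 \<partial>(std_normal_vec :: (real^'d) measure))"
    using std_normal_vec_const[where 'd='d]
    by (subst nn_integral_eq_integral) (auto simp: has_bochner_integral_iff)
  then show ?thesis by (simp add: std_normal_vec_eq)
qed

lemma std_normal_vec_coord: "has_bochner_integral std_normal_vec (\<lambda>z::real^'d. z $ k) 0"
proof -
  have 1: "(\<Prod>i\<in>UNIV. (z $ i) ^ (if i = k then 1 else 0)) = z $ k" for z :: "real^'d"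
    by (subst prod.remove[of _ k]) (auto intro!: prod.neutral)
  have 2: "(\<Prod>i\<in>UNIV. if (if i = k then 1 else 0 :: nat) = 1 then 0 else 1 :: real) = 0"
    by (rule prod_zero) auto
  show ?thesis using std_normal_vec_prod_moment[of "\<lambda>i. if i = k then 1 else 0"] unfolding 1 2 by simp
qed

lemma std_normal_vec_coord_mult:
  "has_bochner_integral std_normal_vec (\<lambda>z::real^'d. z $ k * z $ l) (if k = l then 1 else 0)"
proof -
  \<comment> \<open>For k = l this is one exponent 2, otherwise two exponents 1.\<close>
  let ?e = "\<lambda>i. (if i = k then 1 else 0) + (if i = l then 1 else 0 :: nat)"
  have 1: "(\<Prod>i\<in>UNIV. (z $ i) ^ ?e i) = z $ k * z $ l" for z :: "real^'d"
  proof -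
    have p: "(\<Prod>i\<in>UNIV. (z $ i) ^ (if i = k then 1 else 0)) = z $ k" for k
      by (subst prod.remove[of _ k]) (auto intro!: prod.neutral)
    show ?thesis unfolding power_add prod.distrib p ..
  qed
  have 2: "(\<Prod>i\<in>UNIV. if ?e i = 1 then 0 else 1 :: real) = (if k = l then 1 else 0)"
  proof (cases "k = l")
    case True then show ?thesis by (auto intro!: prod.neutral)
  next
    case False
    then have "(\<Prod>i\<in>UNIV. if ?e i = 1 then 0 else 1 :: real) = 0" by (intro prod_zero) auto
    with False show ?thesis by simp
  qed
  show ?thesis using std_normal_vec_prod_moment[of ?e] unfolding 1 2 by simp
qed

lemma std_normal_vec_norm_square:
  "has_bochner_integral std_normal_vec (\<lambda>z::real^'d. (norm z)\<^sup>2) (real CARD('d))"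
proof -
  have "has_bochner_integral std_normal_vec (\<lambda>z::real^'d. \<Sum>i\<in>UNIV. z $ i * z $ i) (\<Sum>i\<in>(UNIV::'d set). 1)"
    by (rule has_bochner_integral_sum) (use std_normal_vec_coord_mult[of i i for i] in simp)
  moreover have "(\<Sum>i\<in>UNIV. z $ i * z $ i) = (norm z)\<^sup>2" for z :: "real^'d"
    by (simp add: norm_vec_def L2_set_def sum_nonneg power2_eq_square)
  ultimately show ?thesis by simp
qed

lemma affine_measurable: "(\<lambda>z::real^'d. (A :: real^'d^'d) *v z + c) \<in> borel_measurable borel"
  by (intro borel_measurable_continuous_onI continuous_intros linear_continuous_on)
     (simp add: linear_linear)

lemma std_normal_vec_covariance:
  fixes A :: "real^'d^'d"
  assumes X: "X \<in> borel_measurable M"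
    and D: "distr M borel X = distr std_normal_vec borel (\<lambda>z. A *v z + c)"
  shows "covariance_matrix M X = A ** transpose A"
proof -
  let ?g = "\<lambda>z. A *v z + c"
  have gm: "?g \<in> measurable std_normal_vec borel"
    using affine_measurable by (simp add: std_normal_vec_def)
  have tr: "(\<integral>\<omega>. h (X \<omega>) \<partial>M) = (\<integral>z. h (?g z) \<partial>std_normal_vec)"
    if "h \<in> borel_measurable borel" for h :: "real^'d \<Rightarrow> real"
    using integral_distr[OF X that] integral_distr[OF gm that] D by simp
  have co: "?g z $ i = (\<Sum>k\<in>UNIV. A $ i $ k * z $ k) + c $ i" for z i
    by (simp add: matrix_vector_mult_def)
  have mean: "(\<integral>\<omega>. X \<omega> $ i \<partial>M) = c $ i" for i
  proof -
    have "(\<integral>\<omega>. X \<omega> $ i \<partial>M) = (\<integral>z. ?g z $ i \<partial>std_normal_vec)" by (rule tr) measurable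
    also have "has_bochner_integral std_normal_vec (\<lambda>z. ?g z $ i) ((\<Sum>k\<in>UNIV. A $ i $ k * 0) + c $ i * 1)"
      unfolding co
      using has_bochner_integral_mult_right[OF std_normal_vec_const, of "c $ i"]
      by (intro has_bochner_integral_add has_bochner_integral_sum has_bochner_integral_mult_right std_normal_vec_coord) simp
    then have "(\<integral>z. ?g z $ i \<partial>std_normal_vec) = c $ i" by (simp add: has_bochner_integral_iff)
    finally show ?thesis .
  qed
  have "covariance_matrix M X $ i $ j = (A ** transpose A) $ i $ j" for i j
  proof -
    have "covariance_matrix M X $ i $ j = (\<integral>\<omega>. (X \<omega> $ i - c $ i) * (X \<omega> $ j - c $ j) \<partial>M)"
      by (simp add: covariance_matrix_def mean)
    also have "\<dots> = (\<integral>z. (?g z $ i - c $ i) * (?g z $ j - c $ j) \<partial>std_normal_vec)"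
      by (rule tr) measurable
    also have "\<dots> = (\<integral>z. (\<Sum>k\<in>UNIV. \<Sum>l\<in>UNIV. (A $ i $ k * A $ j $ l) * (z $ k * z $ l)) \<partial>std_normal_vec)"
      unfolding co by (simp add: sum_product mult_ac)
    also have "\<dots> = (\<Sum>k\<in>UNIV. \<Sum>l\<in>UNIV. (A $ i $ k * A $ j $ l) * (if k = l then 1 else 0))"
      by (intro has_bochner_integral_integral_eq has_bochner_integral_sum has_bochner_integral_mult_right std_normal_vec_coord_mult)
    also have "\<dots> = (A ** transpose A) $ i $ j"
      by (simp add: matrix_matrix_mult_def transpose_def if_distrib cong: if_cong)
    finally show ?thesis .
  qed
  then show ?thesis by (simp add: vec_eq_iff)
qed

text \<open>Tested on a Borel set: shift by \<open>c\<close>, substitute y = A z, and the Jacobian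
  cancels the division by \<open>\<bar>det A\<bar>\<close>.\<close>

lemma distr_affine_std_normal_vec:
  fixes A B :: "real^'d^'d"
  assumes BA: "B ** A = mat 1" and det: "det A \<noteq> 0"
  shows "distr std_normal_vec borel (\<lambda>z. A *v z + c)
    = density lborel (\<lambda>y. ennreal (std_vec_density (B *v (y - c)) / \<bar>det A\<bar>))"
proof (rule measure_eqI)
  let ?g = "\<lambda>z. A *v z + c" and ?f = "\<lambda>y. std_vec_density (B *v (y - c)) / \<bar>det A\<bar>"
  note gm[measurable] = affine_measurable[of A c]
  fix S assume "S \<in> sets (distr std_normal_vec borel ?g)"
  then have S[measurable]: "S \<in> sets borel" by simp
  have fm[measurable]: "?f \<in> borel_measurable borel" by measurable
  let ?h = "\<lambda>y. ennreal (?f y) * indicator S y"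
  have "emeasure (density lborel (\<lambda>y. ennreal (?f y))) S = (\<integral>\<^sup>+y. ?h y \<partial>lborel)"
    by (simp add: emeasure_density)
  also have "\<dots> = (\<integral>\<^sup>+y. ?h y \<partial>distr lborel borel ((+) c))" by (simp only: lborel_distr_plus)
  also have "\<dots> = (\<integral>\<^sup>+y. ?h (c + y) \<partial>lborel)" by (rule nn_integral_distr) auto
  also have "\<dots> = ennreal \<bar>det A\<bar> * (\<integral>\<^sup>+z. ?h (c + A *v z) \<partial>lborel)"
    by (rule nn_integral_matrix[OF _ det]) measurable
  also have "\<dots> = (\<integral>\<^sup>+z. ennreal \<bar>det A\<bar> * ?h (c + A *v z) \<partial>lborel)"
    by (rule nn_integral_cmult[symmetric]) measurable
  also have "\<dots> = (\<integral>\<^sup>+z. ennreal (std_vec_density z) * indicator (?g -` S) z \<partial>lborel)"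
  proof (rule nn_integral_cong)
    fix z
    have "B *v (A *v z) = z" by (simp add: matrix_vector_mul_assoc BA)
    then have "ennreal \<bar>det A\<bar> * ennreal (?f (c + A *v z)) = ennreal (std_vec_density z)"
      using det std_vec_density_nonneg[of z] by (simp add: ennreal_mult[symmetric])
    moreover have "indicator S (c + A *v z) = (indicator (?g -` S) z :: ennreal)"
      by (simp add: indicator_def add.commute)
    ultimately show "ennreal \<bar>det A\<bar> * ?h (c + A *v z) = ennreal (std_vec_density z) * indicator (?g -` S) z"
      by (simp only: mult.assoc[symmetric])
  qed
  also have "\<dots> = emeasure std_normal_vec (?g -` S)"
  proof -
    have "?g -` S \<in> sets borel" using measurable_sets[OF gm S] by simp
    then show ?thesis unfolding std_normal_vec_eq by (simp add: emeasure_density)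
  qed
  also have "\<dots> = emeasure (distr std_normal_vec borel ?g) S"
    by (subst emeasure_distr) (auto simp: std_normal_vec_eq)
  finally show "emeasure (distr std_normal_vec borel ?g) S = emeasure (density lborel (\<lambda>y. ennreal (?f y))) S" ..
qed simp

lemma det_scaleR: "det (k *\<^sub>R (A :: real^'d^'d)) = k ^ CARD('d) * det A"
proof -
  have "k *\<^sub>R A = (\<chi> i. k *s A $ i)" by (simp add: vec_eq_iff)
  then show ?thesis using det_rows_mul[of "\<lambda>_. k" "\<lambda>i. A $ i"] by simp
qed

lemma matrix_vector_mult_bound:
  fixes A :: "real^'d^'d"
  obtains L where "L > 0" "\<And>x. norm (A *v x) \<le> L * norm x"
  using linear_bounded_pos[of "(*v) A"] by (auto simp: mult.commute linear_linear)

text \<open>The density is a constant times exp (- |B (y - c)|^2 / 2). Boundedness of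
  \<open>B\<close> gives the lower bound and boundedness of its inverse \<open>A\<close> the upper
  one. The estimate |u + v|^2 <= 2 |u|^2 + 2 |v|^2 moves the centre \<open>c\<close> into the
  constants at the price of a factor 2 in the rates.\<close>

lemma gaussian_bounds_affine:
  fixes A B :: "real^'d^'d"
  assumes AB: "A ** B = mat 1" "B ** A = mat 1" and det: "det A \<noteq> 0"
    and f: "f = (\<lambda>y. std_vec_density (B *v (y - c)) / \<bar>det A\<bar>)"
  obtains k C b K where "gaussian_bounds f k C b K (unit_ball_vol (real CARD('d))) CARD('d)"
proof -
  obtain L where L: "L > 0" "\<And>x. norm (B *v x) \<le> L * norm x" using matrix_vector_mult_bound[of B] by blast
  obtain L' where L': "L' > 0" "\<And>x. norm (A *v x) \<le> L' * norm x" using matrix_vector_mult_bound[of A] by blast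
  define a where "a = (1 / sqrt (2 * pi)) ^ CARD('d) / \<bar>det A\<bar>"
  have a: "a > 0" using det by (simp add: a_def)
  have fe: "f y = a * exp (- (norm (B *v (y - c)))\<^sup>2 / 2)" for y
    by (simp add: f std_vec_density_eq a_def)
  have sq2: "(norm (u + v))\<^sup>2 \<le> 2 * (norm u)\<^sup>2 + 2 * (norm v)\<^sup>2" for u v :: "real^'d"
  proof -
    have "(norm (u + v))\<^sup>2 \<le> (norm u + norm v)\<^sup>2" by (intro power_mono norm_triangle_ineq) auto
    also have "\<dots> \<le> 2 * (norm u)\<^sup>2 + 2 * (norm v)\<^sup>2"
      using zero_le_power2[of "norm u - norm v"] by (simp add: power2_sum power2_diff)
    finally show ?thesis .
  qed
  have lo: "(norm (B *v (y - c)))\<^sup>2 / 2 \<le> L\<^sup>2 * (norm y)\<^sup>2 + L\<^sup>2 * (norm c)\<^sup>2" for y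
  proof -
    have "(norm (B *v (y - c)))\<^sup>2 \<le> (L * norm (y - c))\<^sup>2" by (intro power_mono L) auto
    also have "\<dots> \<le> L\<^sup>2 * (2 * (norm y)\<^sup>2 + 2 * (norm c)\<^sup>2)"
      using sq2[of y "- c"] by (simp add: power_mult_distrib mult_left_mono)
    finally show ?thesis by (simp add: algebra_simps)
  qed
  have up: "(norm y)\<^sup>2 \<le> 2 * L'\<^sup>2 * (norm (B *v (y - c)))\<^sup>2 + 2 * (norm c)\<^sup>2" for y
  proof -
    have "y = A *v (B *v (y - c)) + c" by (simp add: matrix_vector_mul_assoc AB)
    then have "(norm y)\<^sup>2 \<le> 2 * (norm (A *v (B *v (y - c))))\<^sup>2 + 2 * (norm c)\<^sup>2"
      using sq2[of "A *v (B *v (y - c))" c] by simp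
    moreover have "(norm (A *v (B *v (y - c))))\<^sup>2 \<le> (L' * norm (B *v (y - c)))\<^sup>2"
      by (intro power_mono L') auto
    ultimately show ?thesis by (simp add: power_mult_distrib)
  qed
  have cont: "continuous_on UNIV (\<lambda>y. B *v (y - c))"
    by (rule linear_continuous_on_compose[where g="(*v) B" and f="\<lambda>y. y - c"])
       (auto intro: continuous_intros)
  show ?thesis
  proof (rule that[of "a * exp (- (L\<^sup>2 * (norm c)\<^sup>2))" "L\<^sup>2" "1 / (4 * L'\<^sup>2)"
        "a * exp ((norm c)\<^sup>2 / (2 * L'\<^sup>2))"], unfold_locales)
    show "continuous_on UNIV f"
      unfolding fe[abs_def] by (intro continuous_intros cont) simp
    show "0 < a * exp (- (L\<^sup>2 * (norm c)\<^sup>2))" "0 < L\<^sup>2" "0 < 1 / (4 * L'\<^sup>2)" using a L L' by auto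
    show "a * exp (- (L\<^sup>2 * (norm c)\<^sup>2)) * exp (- L\<^sup>2 * (norm y)\<^sup>2) \<le> f y" for y
    proof -
      have "exp (- (L\<^sup>2 * (norm c)\<^sup>2)) * exp (- L\<^sup>2 * (norm y)\<^sup>2) \<le> exp (- (norm (B *v (y - c)))\<^sup>2 / 2)"
        using lo[of y] by (simp add: exp_add[symmetric])
      then show ?thesis unfolding fe mult.assoc using a by (intro mult_left_mono) auto
    qed
    show "f y \<le> a * exp ((norm c)\<^sup>2 / (2 * L'\<^sup>2)) * exp (- (1 / (4 * L'\<^sup>2)) * (norm y)\<^sup>2)" for y
    proof -
      have "(norm y)\<^sup>2 / (4 * L'\<^sup>2) \<le> (2 * L'\<^sup>2 * (norm (B *v (y - c)))\<^sup>2 + 2 * (norm c)\<^sup>2) / (4 * L'\<^sup>2)"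
        using up[of y] by (intro divide_right_mono) auto
      also have "\<dots> = (norm (B *v (y - c)))\<^sup>2 / 2 + (norm c)\<^sup>2 / (2 * L'\<^sup>2)"
        using L' by (simp add: field_simps)
      finally have "exp (- (norm (B *v (y - c)))\<^sup>2 / 2)
          \<le> exp ((norm c)\<^sup>2 / (2 * L'\<^sup>2) + - (1 / (4 * L'\<^sup>2)) * (norm y)\<^sup>2)"
        unfolding exp_le_cancel_iff by simp
      then show ?thesis unfolding fe mult.assoc exp_add[symmetric] using a by (intro mult_left_mono) auto
    qed
    have "(\<integral>\<^sup>+x. ennreal (f x) \<partial>lborel) = emeasure (density lborel (\<lambda>y. ennreal (f y))) UNIV"
    proof -
      have "f \<in> borel_measurable borel" unfolding f by measurable
      then show ?thesis by (simp add: emeasure_density)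
    qed
    also have "\<dots> = emeasure std_normal_vec (UNIV :: (real^'d) set)"
      unfolding f distr_affine_std_normal_vec[OF AB(2) det, symmetric]
      using affine_measurable[of A c] by (subst emeasure_distr) (auto simp: std_normal_vec_eq)
    also have "\<dots> = 1" by (rule emeasure_std_normal_vec)
    finally show "(\<integral>\<^sup>+x. ennreal (f x) \<partial>lborel) = 1" .
  qed simp_all
qed

theorem corollary4:
  fixes M :: "'a measure"
    and \<xi> :: "'a \<Rightarrow> real ^ 'd"
    and X :: "nat \<Rightarrow> 'a \<Rightarrow> real ^ 'd"
    and \<nu> :: "real ^ 'd"
    and \<Sigma> :: "real ^ 'd ^ 'd"
  assumes "prob_space M"
    and "gaussian_vector M \<xi>"
    and "(\<integral>\<omega>. \<xi> \<omega> \<partial>M) = \<nu>"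
    and "covariance_matrix M \<xi> = \<Sigma>"
    and "invertible \<Sigma>"
    and "prob_space.indep_vars M (\<lambda>_. borel) X {1..}"
    and "\<And>i. i \<ge> 1 \<Longrightarrow> distr M borel (X i) = distr M borel \<xi>"
  shows "\<exists>f. is_density_of f M \<xi> \<and> integrable lborel (\<lambda>x. f x * ln (f x)) \<and>
    (let H = differential_entropy f; H\<^sub>N = (\<lambda>N \<omega>. kl_estimate (\<lambda>i. X i \<omega>) N) in
       H = 1 / 2 * ln (det ((2 * pi * exp 1) *\<^sub>R \<Sigma>)) \<and>
       (\<forall>N\<ge>2. integrable M (H\<^sub>N N) \<and> integrable M (\<lambda>\<omega>. (H\<^sub>N N \<omega> - H)\<^sup>2)) \<and>
       (\<lambda>N. \<integral>\<omega>. H\<^sub>N N \<omega> \<partial>M) \<longlonglongrightarrow> H \<and>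
       (\<lambda>N. \<integral>\<omega>. (H\<^sub>N N \<omega> - H)\<^sup>2 \<partial>M) \<longlonglongrightarrow> 0)"
proof -
  obtain A :: "real^'d^'d" and c where \<xi>: "\<xi> \<in> borel_measurable M"
    and D: "distr M borel \<xi> = distr std_normal_vec borel (\<lambda>z. A *v z + c)"
    using assms(2) unfolding gaussian_vector_def by blast
  \<comment> \<open>The definition of \<open>gaussian_vector\<close> supplies some \<open>A\<close>,
    linked to the covariance only here; as det \<Sigma> is the square of det A, nondegeneracy passes
    to \<open>A\<close>.\<close>
  have \<Sigma>: "\<Sigma> = A ** transpose A" using std_normal_vec_covariance[OF \<xi> D] assms(4) by simp
  then have detS: "det \<Sigma> = (det A)\<^sup>2" by (simp add: det_mul det_transpose power2_eq_square)
  have det: "det A \<noteq> 0" using assms(5) by (auto simp: invertible_det_nz detS)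
  then obtain B where B: "A ** B = mat 1" "B ** A = mat 1"
    by (auto simp: invertible_det_nz[symmetric] invertible_def)
  define f where "f = (\<lambda>y. std_vec_density (B *v (y - c)) / \<bar>det A\<bar>)"
  obtain k C b K where gb: "gaussian_bounds f k C b K (unit_ball_vol (real CARD('d))) CARD('d)"
    using gaussian_bounds_affine[OF B det f_def] by blast
  interpret G: gaussian_bounds f k C b K "unit_ball_vol (real CARD('d))" "CARD('d)" by (rule gb)
  have mu: "distr M borel \<xi> = G.\<mu>"
    unfolding D G.\<mu>_def unfolding f_def by (rule distr_affine_std_normal_vec[OF B(2) det])
  interpret S: iid_sample f k C b K "unit_ball_vol (real CARD('d))" "CARD('d)" M X
    by (intro iid_sample.intro gb assms(1) iid_sample_axioms.intro assms(6)) (simp add: assms(7) mu)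
  have dens: "is_density_of f M \<xi>"
  proof -
    have "distr M lborel \<xi> = distr M borel \<xi>" by (rule distr_cong) auto
    then show ?thesis
      using \<xi> G.f_pos mu by (simp add: is_density_of_def distributed_def G.\<mu>_def less_imp_le)
  qed
  have int: "integrable lborel (\<lambda>x. f x * ln (f x))"
    using G.integrable_ln_f by (subst (asm) G.integrable_mu_iff) auto
  have ent: "differential_entropy f = - (\<integral>x. ln (f x) \<partial>G.\<mu>)"
    unfolding differential_entropy_def G.\<mu>_def
    by (subst integral_density) (auto intro: less_imp_le G.f_pos)
  have H: "differential_entropy f = 1 / 2 * ln (det ((2 * pi * exp 1) *\<^sub>R \<Sigma>))"
  proof -
    let ?d = "real CARD('d)"
    \<comment> \<open>The factor \<open>* 1\<close> keeps the constant in the shape integrated by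
      \<open>std_normal_vec_const\<close>. The quadratic term has mean d / 2, which becomes the
      factor e inside the logarithm.\<close>
    have ln_f: "ln (f (A *v z + c)) = - (?d / 2 * ln (2 * pi) + ln \<bar>det A\<bar>) * 1 - 1 / 2 * (norm z)\<^sup>2" for z
    proof -
      have "B *v (A *v z) = z" by (simp add: matrix_vector_mul_assoc B)
      then have "f (A *v z + c) = (1 / sqrt (2 * pi)) ^ CARD('d) * exp (- (norm z)\<^sup>2 / 2) / \<bar>det A\<bar>"
        by (simp add: f_def std_vec_density_eq)
      then show ?thesis
        using det by (simp add: ln_div ln_mult ln_realpow ln_sqrt)
    qed
    have "(\<integral>x. ln (f x) \<partial>G.\<mu>) = (\<integral>z. ln (f (A *v z + c)) \<partial>std_normal_vec)"
      unfolding mu[symmetric] D using affine_measurable[of A c]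
      by (subst integral_distr) (auto simp: std_normal_vec_eq)
    also have "\<dots> = - (?d / 2 * ln (2 * pi) + ln \<bar>det A\<bar>) * 1 - 1 / 2 * ?d"
      unfolding ln_f
      by (intro has_bochner_integral_integral_eq has_bochner_integral_diff has_bochner_integral_mult_right
          std_normal_vec_const std_normal_vec_norm_square)
    finally have "differential_entropy f = ?d / 2 * (ln (2 * pi) + 1) + ln \<bar>det A\<bar>"
      unfolding ent by (simp add: algebra_simps)
    also have "\<dots> = 1 / 2 * ln ((2 * pi * exp 1) ^ CARD('d) * \<bar>det A\<bar>\<^sup>2)"
    proof -
      have "?d / 2 * (ln (2 * pi) + 1) + ln e = 1 / 2 * ln ((2 * pi * exp 1) ^ CARD('d) * e\<^sup>2)" if "e > 0" for e
        using that by (simp add: ln_mult ln_realpow field_simps)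
      from this[of "\<bar>det A\<bar>"] det show ?thesis unfolding zero_less_abs_iff by blast
    qed
    also have "\<dots> = 1 / 2 * ln (det ((2 * pi * exp 1) *\<^sub>R \<Sigma>))"
      by (simp only: det_scaleR detS power2_abs)
    finally show ?thesis .
  qed
  note est = S.estimate_consistent[folded ent kl_estimate_def]
  show ?thesis
    unfolding Let_def using dens int H est by blast
qed

end
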